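(* Assume $m>2$ and $m\neq 6$. Let $F$ and $G$ be $(q_1,r_1)$- and $(q_2,r_2)$-biprojective polynomial pairs on $\mathbb M\times\mathbb M$ respectively, with $q_i=2^{k_i}$ and $r_i=2^{l_i}$, where $k_1,l_1\neq m/2$ and $k_1\not\equiv\pm l_1\pmod m$. Assume further that $p$ does not divide the index $[C_F:Z^{(q_1,r_1)}]$. Then $F$ and $G$ are EL-equivalent if and only if they are EL-equivalent via a mapping $\gamma=\begin{pmatrix} M & 0 \\ N & L \end{pmatrix}$ where $M,L\in\mathrm{GL}(\mathbb F)$ and, writing $M=\begin{pmatrix} M_1 & M_2 \\ M_3 & M_4 \end{pmatrix}$, $L=\begin{pmatrix} L_1 & L_2 \\ L_3 & L_4 \end{pmatrix}$, the subfunctions $M_1,M_2,M_3,M_4,L_1,L_2,L_3,L_4:\mathbb M\to\mathbb M$ are monomials (written as linearized polynomials) of the same degree, say $2^t$, or zero. Furthermore, we have either (A) - $L_2=L_3=0$, - $k_1\equiv\pm k_2\pmod m$ and $l_1\equiv\pm l_2\pmod m$, - if $k_1\equiv k_2\pmod m$ (resp. $l_1\equiv l_2\pmod m$), then $L_1$ (resp. $L_4$) has degree $2^t$, - if $k_1\equiv -k_2\pmod m$ (resp. $l_1\equiv -l_2\pmod m$), then $L_1$ (resp. $L_4$) has degree $2^{m-t}$; or (B) - $L_1=L_4=0$, - $k_1\equiv\pm l_2\pmod m$ and $l_1\equiv\pm k_2\pmod m$, - if $l_1\equiv k_2\pmod m$ (resp. $k_1\equiv l_2\pmod m$), then $L_2$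 (resp. $L_3$) has degree $2^t$, - if $l_1\equiv -k_2\pmod m$ (resp. $k_1\equiv -l_2\pmod m$), then $L_2$ (resp. $L_3$) has degree $2^{m-t}$. If additionally $k_1,l_1\not\equiv 0\pmod m$, then $N=0$, that is, $F$ and $G$ are even linear equivalent.
   Context: Let $\mathbb M=\mathbb F_{2^m}$, $n=2m$, and identify $\mathbb F=\mathbb F_{2^n}$ with $\mathbb M\times\mathbb M$ as $\mathbb F_2$-vector space. All linearity is over $\mathbb F_2$: $\mathrm{GL}(\mathbb F)\cong\mathrm{GL}(n,\mathbb F_2)$, $\mathrm{GL}(\mathbb F\times\mathbb F)\cong\mathrm{GL}(2n,\mathbb F_2)$. For $q=2^k$, $r=2^l$ with $k,l\ge 0$, a $(q,r)$-biprojective polynomial pair is a function $F(x,y)=(f(x,y),g(x,y))$ on $\mathbb M\times\mathbb M$ with $f=a_0x^{q+1}+b_0x^qy+c_0xy^q+d_0y^{q+1}$ and $g=a_1x^{r+1}+b_1x^ry+c_1xy^r+d_1y^{r+1}$, where all coefficients lie in $\mathbb M$. The graph of $F:\mathbb F\to\mathbb F$ is $\Gamma_F=\{(x,F(x)):x\in\mathbb F\}$. Let $\mathrm{ELM}$ be the group of all $\begin{pmatrix} M & 0 \\ N & L \end{pmatrix}\in\mathrm{GL}(\mathbb F\times\mathbb F)$ ($M,N,L$ being $\mathbb F_2$-linear maps $\mathbb F\to\mathbb F$). $F$ and $G$ are EL-equivalent (via $\gamma$) if $\gamma(\Gamma_F)=\Gamma_G$ for some $\gamma\in\mathrm{ELM}$;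 they are linear equivalent if this holds with $N=0$. $\mathrm{Aut}_{\mathrm{EL}}(F)=\{\mathcal A\in\mathrm{ELM}:\mathcal A(\Gamma_F)=\Gamma_F\}$. Let $p$ be a primitive prime divisor of $2^m-1$, i.e. a prime dividing $2^m-1$ but not $2^i-1$ for $1\le i<m$ (it exists since $m>1$, $m\ne 6$), and let $P$ be the unique Sylow $p$-subgroup of $\mathbb M^\times$. For $a\in\mathbb M^\times$ let $m_a:\mathbb M\to\mathbb M$, $x\mapsto ax$. Put $Z^{(q,r)}=\{\mathrm{diag}(m_a,m_a,m_{a^{q+1}},m_{a^{r+1}}):a\in\mathbb M^\times\}\le\mathrm{GL}(\mathbb F\times\mathbb F)$ (acting on $\mathbb M^4=\mathbb F\times\mathbb F$) and let $Z_P^{(q,r)}$ be the subgroup of those elements with $a\in P$. For a $(q,r)$-biprojective pair $F$ one has $Z_P^{(q,r)}\le Z^{(q,r)}\le\mathrm{Aut}_{\mathrm{EL}}(F)$, and $C_F$ denotes the centralizer of $Z_P^{(q,r)}$ in $\mathrm{Aut}_{\mathrm{EL}}(F)$. A map $\mathbb M\to\mathbb M$ is a monomial of degree $2^s$ if it has the form $x\mapsto cx^{2^s}$ with $c\in\mathbb M^\times$; the exponent $s$ is read modulo $m$.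
   Formalization: The L_i need not share the degree 2^t of the M_i; where a "≡ −" congruence holds, the degree 2^{m−t} is corrected to 2^{t+k_2} (for L_1, L_2) or 2^{t+l_2} (for L_3, L_4), as the printed degrees are inconsistent; k_1,l_1≠m/2 is read modulo m. *)

theory Defs
  imports
    Complex_Main
    "HOL-Number_Theory.Cong"
    "HOL-Computational_Algebra.Primes"
    "HOL-Library.Z2"
    "HOL-Library.Cardinality"
    "HOL-Library.Product_Plus"
    "HOL-Algebra.Coset"
begin

text \<open>
  Throughout, \<open>'a\<close> is the field \<open>M\<close> with \<open>2^m\<close> elements and \<open>'a \<times> 'a\<close> is \<open>F\<close>.
  The two-element field is the type \<^typ>\<open>bit\<close>.
\<close>

definition F2_scale :: "bit \<Rightarrow> 'v::ab_group_add \<Rightarrow> 'v" where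
  "F2_scale b v = (if b = 0 then 0 else v)"

text \<open>
  Linearity over the two-element field. The library predicate includes the vector space axioms
  for \<open>F2_scale\<close> on both sides; they hold exactly when \<open>v + v = 0\<close> for all \<open>v\<close>.
\<close>

definition F2_linear :: "('v::ab_group_add \<Rightarrow> 'w::ab_group_add) \<Rightarrow> bool" where
  "F2_linear T \<longleftrightarrow> Vector_Spaces.linear F2_scale F2_scale T"

definition GL :: "('v::ab_group_add \<Rightarrow> 'v) set" where
  "GL = {T. F2_linear T \<and> bij T}"

text \<open>The map with block matrix \<open>(A B; C D)\<close>, acting on column vectors.\<close>

definition block ::
  "('v::ab_group_add \<Rightarrow> 'v) \<Rightarrow> ('v \<Rightarrow> 'v) \<Rightarrow> ('v \<Rightarrow> 'v) \<Rightarrow> ('v \<Rightarrow> 'v) \<Rightarrow> 'v \<times> 'v \<Rightarrow> 'v \<times> 'v" where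
  "block A B C D = (\<lambda>(x, y). (A x + B y, C x + D y))"

definition ELM :: "(('v::ab_group_add \<times> 'v) \<Rightarrow> ('v \<times> 'v)) set" where
  "ELM = {\<gamma> \<in> GL. \<exists>M N L. F2_linear M \<and> F2_linear N \<and> F2_linear L \<and> \<gamma> = block M (\<lambda>_. 0) N L}"

definition ELM_group :: "(('v::ab_group_add \<times> 'v) \<Rightarrow> ('v \<times> 'v)) monoid" where
  "ELM_group = \<lparr>carrier = ELM, mult = (\<circ>), one = id\<rparr>"

definition graph_of :: "('v \<Rightarrow> 'w) \<Rightarrow> ('v \<times> 'w) set" where
  "graph_of F = {(x, F x) | x. True}"

definition EL_equivalent_via ::
  "('v::ab_group_add \<times> 'v \<Rightarrow> 'v \<times> 'v) \<Rightarrow> ('v \<Rightarrow> 'v) \<Rightarrow> ('v \<Rightarrow> 'v) \<Rightarrow> bool" where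
  "EL_equivalent_via \<gamma> F G \<longleftrightarrow> \<gamma> \<in> ELM \<and> \<gamma> ` graph_of F = graph_of G"

definition EL_equivalent :: "('v::ab_group_add \<Rightarrow> 'v) \<Rightarrow> ('v \<Rightarrow> 'v) \<Rightarrow> bool" where
  "EL_equivalent F G \<longleftrightarrow> (\<exists>\<gamma>. EL_equivalent_via \<gamma> F G)"

definition linear_equivalent :: "('v::ab_group_add \<Rightarrow> 'v) \<Rightarrow> ('v \<Rightarrow> 'v) \<Rightarrow> bool" where
  "linear_equivalent F G \<longleftrightarrow>
     (\<exists>M L. EL_equivalent_via (block M (\<lambda>_. 0) (\<lambda>_. 0) L) F G)"

definition Aut_EL :: "('v::ab_group_add \<Rightarrow> 'v) \<Rightarrow> (('v \<times> 'v) \<Rightarrow> ('v \<times> 'v)) set" where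
  "Aut_EL F = {\<A> \<in> ELM. \<A> ` graph_of F = graph_of F}"

definition biprojective :: "nat \<Rightarrow> nat \<Rightarrow> ('a::field \<times> 'a \<Rightarrow> 'a \<times> 'a) \<Rightarrow> bool" where
  "biprojective q r F \<longleftrightarrow>
     (\<exists>a\<^sub>0 b\<^sub>0 c\<^sub>0 d\<^sub>0 a\<^sub>1 b\<^sub>1 c\<^sub>1 d\<^sub>1. F = (\<lambda>(x, y).
        (a\<^sub>0 * x^(q+1) + b\<^sub>0 * x^q * y + c\<^sub>0 * x * y^q + d\<^sub>0 * y^(q+1),
         a\<^sub>1 * x^(r+1) + b\<^sub>1 * x^r * y + c\<^sub>1 * x * y^r + d\<^sub>1 * y^(r+1))))"

definition primitive_prime_divisor :: "nat \<Rightarrow> nat \<Rightarrow> bool" where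
  "primitive_prime_divisor p m \<longleftrightarrow>
     prime p \<and> p dvd 2^m - 1 \<and> (\<forall>i. 1 \<le> i \<and> i < m \<longrightarrow> \<not> p dvd 2^i - 1)"

definition mult_group :: "'a::field monoid" where
  "mult_group = \<lparr>carrier = UNIV - {0}, mult = (*), one = 1\<rparr>"

definition sylow_subgroup :: "nat \<Rightarrow> ('g, 'h) monoid_scheme \<Rightarrow> 'g set \<Rightarrow> bool" where
  "sylow_subgroup p G H \<longleftrightarrow> subgroup H G \<and> card H = p ^ multiplicity p (order G)"

definition centralizer :: "('g, 'h) monoid_scheme \<Rightarrow> 'g set \<Rightarrow> 'g set" where
  "centralizer G S = {g \<in> carrier G. \<forall>s\<in>S. g \<otimes>\<^bsub>G\<^esub> s = s \<otimes>\<^bsub>G\<^esub> g}"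

text \<open>The index of a subgroup \<open>K\<close> in a subgroup \<open>H\<close> of \<open>G\<close>.\<close>

definition subgroup_index :: "('g, 'h) monoid_scheme \<Rightarrow> 'g set \<Rightarrow> 'g set \<Rightarrow> nat" where
  "subgroup_index G H K = card (rcosets\<^bsub>G\<lparr>carrier := H\<rparr>\<^esub> K)"

text \<open>The diagonal map with entries \<open>a, a, a^(q+1), a^(r+1)\<close> on \<open>M^4\<close>.\<close>

definition Z_map :: "nat \<Rightarrow> nat \<Rightarrow> 'a::field \<Rightarrow> ('a \<times> 'a) \<times> ('a \<times> 'a) \<Rightarrow> ('a \<times> 'a) \<times> ('a \<times> 'a)" where
  "Z_map q r a = (\<lambda>((x, y), (u, v)). ((a * x, a * y), (a^(q+1) * u, a^(r+1) * v)))"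

definition Z_group :: "nat \<Rightarrow> nat \<Rightarrow> (('a::field \<times> 'a) \<times> ('a \<times> 'a) \<Rightarrow> ('a \<times> 'a) \<times> ('a \<times> 'a)) set" where
  "Z_group q r = Z_map q r ` (UNIV - {0})"

definition C_group ::
  "nat \<Rightarrow> nat \<Rightarrow> 'a::field set \<Rightarrow> ('a \<times> 'a \<Rightarrow> 'a \<times> 'a) \<Rightarrow>
     (('a \<times> 'a) \<times> ('a \<times> 'a) \<Rightarrow> ('a \<times> 'a) \<times> ('a \<times> 'a)) set" where
  "C_group q r P F = centralizer (ELM_group\<lparr>carrier := Aut_EL F\<rparr>) (Z_map q r ` P)"

text \<open>
  Monomials are compared as functions on \<open>M\<close>, so for \<open>2^m\<close> elements the exponent \<open>s\<close>
  matters only modulo \<open>m\<close>.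
\<close>

definition monomial_of_degree :: "nat \<Rightarrow> ('a::field \<Rightarrow> 'a) \<Rightarrow> bool" where
  "monomial_of_degree s h \<longleftrightarrow> (\<exists>c. c \<noteq> 0 \<and> h = (\<lambda>x. c * x^(2^s)))"

text \<open>
  \<open>F\<close> and \<open>G\<close> are equivalent via \<open>(M 0; N L)\<close> where the blocks of \<open>M\<close> are zero or monomials
  of the common degree \<open>2^t\<close> and the blocks of \<open>L\<close> are zero or monomials. The equivalence says
  \<open>G (M z) = N z + L (F z)\<close>. The degree of a nonzero block of \<open>L\<close> is not prescribed here: for
  \<open>M\<close> of degree \<open>2^t\<close>, a component \<open>x^(2^k\<^sub>2 + 1)\<close> of \<open>G\<close> becomes \<open>x^(2^(t+k\<^sub>2) + 2^t)\<close>. As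
  \<open>c * (x^(2^k\<^sub>1 + 1))^(2^s)\<close> this forces \<open>s = t\<close> if \<open>k\<^sub>1 = k\<^sub>2\<close> modulo \<open>m\<close>, and
  \<open>s = t + k\<^sub>2\<close> if \<open>k\<^sub>1 = -k\<^sub>2\<close> modulo \<open>m\<close>.
\<close>

definition monomial_EL_equivalence ::
  "('a::field \<times> 'a \<Rightarrow> 'a \<times> 'a) \<Rightarrow> ('a \<times> 'a \<Rightarrow> 'a \<times> 'a) \<Rightarrow> nat \<Rightarrow>
     ('a \<Rightarrow> 'a) \<Rightarrow> ('a \<Rightarrow> 'a) \<Rightarrow> ('a \<Rightarrow> 'a) \<Rightarrow> ('a \<Rightarrow> 'a) \<Rightarrow> ('a \<times> 'a \<Rightarrow> 'a \<times> 'a) \<Rightarrow>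
     ('a \<Rightarrow> 'a) \<Rightarrow> ('a \<Rightarrow> 'a) \<Rightarrow> ('a \<Rightarrow> 'a) \<Rightarrow> ('a \<Rightarrow> 'a) \<Rightarrow> bool" where
  "monomial_EL_equivalence F G t M\<^sub>1 M\<^sub>2 M\<^sub>3 M\<^sub>4 N L\<^sub>1 L\<^sub>2 L\<^sub>3 L\<^sub>4 \<longleftrightarrow>
     block M\<^sub>1 M\<^sub>2 M\<^sub>3 M\<^sub>4 \<in> GL \<and> F2_linear N \<and> block L\<^sub>1 L\<^sub>2 L\<^sub>3 L\<^sub>4 \<in> GL \<and>
     EL_equivalent_via (block (block M\<^sub>1 M\<^sub>2 M\<^sub>3 M\<^sub>4) (\<lambda>_. 0) N (block L\<^sub>1 L\<^sub>2 L\<^sub>3 L\<^sub>4)) F G \<and>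
     (\<forall>h \<in> {M\<^sub>1, M\<^sub>2, M\<^sub>3, M\<^sub>4}. h = (\<lambda>_. 0) \<or> monomial_of_degree t h) \<and>
     (\<forall>h \<in> {L\<^sub>1, L\<^sub>2, L\<^sub>3, L\<^sub>4}. h = (\<lambda>_. 0) \<or> (\<exists>s. monomial_of_degree s h))"

end

theory Submission
  imports Defs "HOL-Computational_Algebra.Polynomial" "HOL-Number_Theory.Residues"
begin

text \<open>
  Since \<open>p\<close> is a primitive prime divisor, an element of \<open>P\<close> other than \<open>1\<close> lies in no proper subring
  of \<open>M\<close>. Hence an additive map that intertwines multiplication by such an element with another
  multiplication is zero or a monomial.

  The index hypothesis makes \<open>Z_P\<close> a Sylow \<open>p\<close>-subgroup of \<open>Aut_EL F\<close>: the number of conjugates in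
  \<open>Z_P\<close> of a generator of \<open>Z_P\<close> is at most \<open>m < p\<close>, because they arise from field automorphisms.
  So an equivalence from \<open>F\<close> to \<open>G\<close> can be composed with an automorphism of \<open>F\<close> such that it intertwines
  the tori, and then all its blocks are monomials.

  The hypothesis also forces both components of \<open>F\<close> to be non-additive, for otherwise \<open>F\<close> has a
  second torus of automorphisms. The types (A) and (B) follow by polarizing
  \<open>G (M z) = N z + L (F z)\<close> at \<open>(u z, v w)\<close> and comparing coefficients of the linearly independent
  functions \<open>u^(2^i) v^(2^j)\<close>.
\<close>

subsection \<open>Finite fields of characteristic two\<close>

text \<open>One count carries the field theory: a subring has \<open>2^i\<close> elements, and an
  element other than 1 of \<open>p\<close>-power order in it forces \<open>p dvd 2^i - 1\<close>, so
  \<open>i = m\<close>. The condition on \<open>m/2\<close> keeps \<open>p\<close> from dividing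
  \<open>2^k + 1\<close>. Hence the torus acts nontrivially on both components of the second
  summand; otherwise nothing would force the blocks of \<open>L\<close> to be monomials. Sylow's
  theorems are not invoked. The number of cosets of \<open>Z_P\<close> fixed by an element of
  \<open>p\<close>-power order is congruent to the index modulo \<open>p\<close>, whichever element
  is taken; it is computed for a generator of \<open>Z_P\<close>, whose centralizer is
  \<open>C_F\<close>, and then used for the generator of the torus of \<open>G\<close> transported
  to \<open>F\<close>. No shape is determined for \<open>N\<close>: it drops out on polarizing, and
  homogeneity makes it vanish afterwards when \<open>k\<^sub>1\<close> and \<open>l\<^sub>1\<close>
  are nonzero modulo \<open>m\<close>. Types (A) and (B) are derived for every equivalence with
  monomial blocks, not only for the one constructed.\<close>

lemma finite_field_power_card:
  fixes x :: "'a::{field,finite}"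
  shows "x ^ CARD('a) = x"
proof (cases "x = 0")
  case False
  have "(\<Prod>y\<in>UNIV-{0}. x * y) = (\<Prod>y\<in>UNIV-{0}. y)"
    by (rule prod.reindex_bij_witness[of _ "\<lambda>y. y / x" "\<lambda>y. x * y"]) (use False in auto)
  then have "x ^ (CARD('a) - 1) = 1"
    by (simp add: prod.distrib)
  then have "x * x ^ (CARD('a) - 1) = x"
    by simp
  moreover have "Suc (CARD('a) - 1) = CARD('a)"
    by simp
  ultimately show ?thesis
    by (metis power_Suc)
qed simp

lemma CHAR_eq_2:
  assumes "CARD('a::{field,finite}) = 2 ^ m"
  shows "CHAR('a) = 2"
proof -
  have "CHAR('a) dvd 2 ^ m"
    using CHAR_dvd_CARD[where 'a = 'a] assms by simp
  moreover have "prime CHAR('a)"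
    by (rule prime_CHAR_semidom) (simp add: finite_imp_CHAR_pos)
  ultimately show ?thesis
    using prime_dvd_power two_is_prime_nat primes_dvd_imp_eq by metis
qed

lemma add_self_eq_0:
  assumes "CARD('a::{field,finite}) = 2 ^ m"
  shows "(x::'a) + x = 0"
proof -
  have "of_nat 2 = (0::'a)"
    using CHAR_eq_2[OF assms] of_nat_CHAR[where 'a = 'a] by simp
  then show ?thesis
    by (metis mult_2 mult_zero_left of_nat_numeral)
qed

lemma minus_eq_self:
  assumes "CARD('a::{field,finite}) = 2 ^ m"
  shows "- (x::'a) = x"
  using add_self_eq_0[OF assms, of x] by (simp add: minus_unique)

lemma frobenius_add:
  assumes "CARD('a::{field,finite}) = 2 ^ m"
  shows "((x::'a) + y) ^ (2 ^ i) = x ^ (2 ^ i) + y ^ (2 ^ i)"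
  by (rule freshmans_dream'[where n = i]) (simp_all add: CHAR_eq_2[OF assms])

lemma frobenius_sum:
  assumes "CARD('a::{field,finite}) = 2 ^ m"
  shows "(sum f A :: 'a) ^ (2 ^ i) = (\<Sum>x\<in>A. f x ^ (2 ^ i))"
  by (rule freshmans_dream_sum'[where n = i]) (simp_all add: CHAR_eq_2[OF assms])

lemma frobenius_mod:
  assumes "CARD('a::{field,finite}) = 2 ^ m"
  shows "(x::'a) ^ (2 ^ (i mod m)) = x ^ (2 ^ i)"
proof -
  have *: "(y::'a) ^ (2 ^ (m * j)) = y" for y j
  proof (induction j)
    case (Suc j)
    have "y ^ (2 ^ (m * Suc j)) = (y ^ (2 ^ m)) ^ (2 ^ (m * j))"
      by (simp add: power_add flip: power_mult)
    then show ?case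
      using Suc finite_field_power_card[of y] assms by simp
  qed simp
  have "x ^ (2 ^ i) = x ^ (2 ^ (m * (i div m) + i mod m))"
    by simp
  also have "\<dots> = (x ^ (2 ^ (m * (i div m)))) ^ (2 ^ (i mod m))"
    by (simp only: power_add power_mult)
  finally show ?thesis
    by (simp add: *)
qed

text \<open>The exponents \<open>2^i\<close> with \<open>i < m\<close> are distinct and at most
  \<open>2^(m-1)\<close>, so a nonzero polynomial of this kind has fewer than \<open>2^m\<close>
  roots.\<close>

lemma linearized_polynomial_eq_0:
  fixes c :: "nat \<Rightarrow> 'a::{field,finite}"
  assumes card: "CARD('a) = 2 ^ m"
    and zero: "\<And>u. (\<Sum>i<m. c i * u ^ (2 ^ i)) = 0"
    and "i < m"
  shows "c i = 0"
proof -
  define q where "q = (\<Sum>i<m. Polynomial.monom (c i) (2 ^ i))"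
  have "poly q u = 0" for u
    using zero by (simp add: q_def poly_sum poly_monom)
  then have roots: "card {x. poly q x = 0} = 2 ^ m"
    using card by simp
  have "degree q \<le> 2 ^ (m - 1)"
    unfolding q_def
    by (intro degree_sum_le) (auto intro!: order_trans[OF degree_monom_le] power_increasing)
  also have "(2::nat) ^ (m - 1) < 2 ^ m"
    using \<open>i < m\<close> by (intro power_strict_increasing) auto
  finally have "q = 0"
    using card_poly_roots_bound[of q] roots by force
  then have "Polynomial.coeff q (2 ^ i) = 0"
    by simp
  moreover have "Polynomial.coeff q (2 ^ i) = (\<Sum>j<m. if j = i then c i else 0)"
    by (auto simp: q_def coeff_sum intro!: sum.cong)
  ultimately show ?thesis
    using \<open>i < m\<close> by simp
qed

text \<open>Independence is applied twice, first in \<open>u\<close> and then in \<open>v\<close>.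
  The terms form a list because their exponents may coincide modulo \<open>m\<close> for some
  parameters and not for others; the conclusion adds up whatever falls into one class.\<close>

lemma bilinearized_polynomial_eq_0:
  fixes xs :: "('a::{field,finite} \<times> nat \<times> nat) list"
  assumes card: "CARD('a) = 2 ^ m" and "m > 0"
    and zero: "\<And>u v. (\<Sum>(c, a, b)\<leftarrow>xs. c * u ^ (2 ^ a) * v ^ (2 ^ b)) = 0"
  shows "(\<Sum>(c, a, b)\<leftarrow>xs. if [a = i] (mod m) \<and> [b = j] (mod m) then c else 0) = 0"
proof -
  define C where
    "C i j = (\<Sum>(c, a, b)\<leftarrow>xs. if a mod m = i \<and> b mod m = j then c else 0)" for i j
  have expand: "(\<Sum>i<m. \<Sum>j<m. (\<Sum>(c, a, b)\<leftarrow>ys. if a mod m = i \<and> b mod m = j then c else 0)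
      * u ^ (2 ^ i) * v ^ (2 ^ j)) = (\<Sum>(c, a, b)\<leftarrow>ys. c * u ^ (2 ^ a) * v ^ (2 ^ b))"
    for u v :: 'a and ys
  proof (induction ys)
    case (Cons y ys)
    obtain c a b where y: "y = (c, a, b)"
      by (cases y)
    have "(\<Sum>i<m. \<Sum>j<m. (if a mod m = i \<and> b mod m = j then c else 0) * u ^ (2 ^ i) * v ^ (2 ^ j))
      = (\<Sum>i<m. \<Sum>j<m. if j = b mod m then
           (if i = a mod m then c * u ^ (2 ^ i) * v ^ (2 ^ j) else 0) else 0)"
      by (intro sum.cong) auto
    also have "\<dots> = (\<Sum>i<m. if i = a mod m then c * u ^ (2 ^ i) * v ^ (2 ^ (b mod m)) else 0)"
      using \<open>m > 0\<close> by (intro sum.cong) (simp_all add: sum.delta)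
    also have "\<dots> = c * u ^ (2 ^ a) * v ^ (2 ^ b)"
      using \<open>m > 0\<close> by (simp add: sum.delta frobenius_mod[OF card])
    finally show ?case
      using Cons by (simp add: y distrib_right sum.distrib)
  qed simp
  have "(\<Sum>i<m. (\<Sum>j<m. C i j * v ^ (2 ^ j)) * u ^ (2 ^ i)) = 0" for u v
    using expand[where ys = xs and u = u and v = v] zero[of u v]
    by (simp add: C_def sum_distrib_right sum_distrib_left mult_ac)
  then have "(\<Sum>j<m. C i j * v ^ (2 ^ j)) = 0" if "i < m" for i v
    using linearized_polynomial_eq_0[OF card, of "\<lambda>i. \<Sum>j<m. C i j * v ^ (2 ^ j)"] that by simp
  then have "C i j = 0" if "i < m" "j < m" for i j
    using linearized_polynomial_eq_0[OF card, of "C i"] that by simp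
  then show ?thesis
    using \<open>m > 0\<close> by (simp add: C_def cong_def)
qed

subsection \<open>Fixed points of permutations of prime power order\<close>

text \<open>The orbit of a moved point has exactly \<open>p\<close> elements; the induction removes
  one such orbit at a time.\<close>

lemma card_cong_card_fixed_points_prime:
  fixes f :: "'b \<Rightarrow> 'b"
  assumes "prime p" "finite X" "f ` X \<subseteq> X" "\<And>x. x \<in> X \<Longrightarrow> (f ^^ p) x = x"
  shows "[card X = card {x \<in> X. f x = x}] (mod p)"
  using assms(2,3,4)
proof (induction X rule: finite_psubset_induct)
  case (psubset X)
  show ?case
  proof (cases "\<exists>x\<in>X. f x \<noteq> x")
    case False
    then have "{x \<in> X. f x = x} = X"
      by auto
    then show ?thesis
      by simp
  next
    case True
    then obtain x where x: "x \<in> X" "f x \<noteq> x"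
      by auto
    have p: "(f ^^ p) x = x"
      using psubset.prems x by simp
    define Q where "Q = (\<lambda>i. (f ^^ i) x) ` {..<p}"
    have Q: "(f ^^ i) x \<in> Q" for i
      unfolding Q_def using funpow_mod_eq[OF p, of i] \<open>prime p\<close>
      by (metis imageI lessThan_iff mod_less_divisor prime_gt_0_nat)
    have X: "(f ^^ i) x \<in> X" for i
      using psubset.prems(1) x by (induction i) auto
    \<comment> \<open>A repetition makes \<open>x\<close> a fixed point of the
      \<open>(j - i)\<close>-th iterate; inverting \<open>j - i\<close> modulo \<open>p\<close>
      would make it a fixed point of \<open>f\<close> itself.\<close>
    have "inj_on (\<lambda>i. (f ^^ i) x) {..<p}"
    proof (rule linorder_inj_onI)
      fix i j :: nat
      assume ij: "i < j" "j \<in> {..<p}"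
      show "(f ^^ i) x \<noteq> (f ^^ j) x"
      proof
        assume eq: "(f ^^ i) x = (f ^^ j) x"
        have "(f ^^ (p - i)) ((f ^^ i) x) = (f ^^ (p - i)) ((f ^^ j) x)"
          by (simp add: eq)
        then have "x = (f ^^ (p + (j - i))) x"
          using ij p by (simp flip: funpow_add comp_apply[of "f ^^ _"])
        then have d: "(f ^^ (j - i)) x = x"
          using ij p by (metis funpow_add add.commute comp_apply)
        have "coprime (j - i) p"
          using ij \<open>prime p\<close> by (metis coprime_commute diff_is_0_eq leD lessThan_iff
              less_imp_diff_less nat_dvd_not_less neq0_conv prime_imp_coprime)
        then obtain a where "[(j - i) * a = 1] (mod p)"
          using cong_solve_coprime_nat by fastforce
        then have "(f ^^ ((j - i) * a)) x = (f ^^ 1) x"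
          using funpow_mod_eq[OF p] by (metis cong_def)
        moreover have "(f ^^ ((j - i) * a)) x = x"
          using funpow_mod_eq[OF d, of "(j - i) * a"] by simp
        ultimately show False
          using x by simp
      qed
    qed auto
    then have cardQ: "card Q = p"
      by (simp add: Q_def card_image)
    \<comment> \<open>Going back along \<open>f\<close> stays in \<open>Q\<close>, so
      \<open>X - Q\<close> is again mapped into itself and the induction applies.\<close>
    have fQ: "z \<in> Q" if z: "z \<in> X" "f z \<in> Q" for z
    proof -
      obtain i where i: "f z = (f ^^ i) x"
        using z by (auto simp: Q_def)
      have "z = (f ^^ (p - 1)) (f z)"
        using psubset.prems(2)[OF z(1)] \<open>prime p\<close>
        by (metis Suc_diff_1 comp_apply funpow_Suc_right prime_gt_0_nat)
      also have "\<dots> = (f ^^ (p - 1 + i)) x"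
        by (simp add: i funpow_add)
      finally show ?thesis
        using Q by metis
    qed
    have "Q \<subseteq> X" "Q \<noteq> {}"
      using X Q by (auto simp: Q_def)
    then have IH: "[card (X - Q) = card {y \<in> X - Q. f y = y}] (mod p)"
      using fQ psubset.prems by (intro psubset.IH) auto
    have "f y \<noteq> y" if yQ: "y \<in> Q" for y
    proof
      assume y: "f y = y"
      obtain i where i: "i < p" "y = (f ^^ i) x"
        using yQ by (auto simp: Q_def)
      have "(f ^^ (p - i)) y = y"
        using y funpow_mod_eq[where f = f and n = 1 and x = y and m = "p - i"] by simp
      moreover have "(f ^^ (p - i)) y = x"
        using i p by (simp flip: funpow_add comp_apply[of "f ^^ _"])
      ultimately show False
        using x y by simp
    qed
    then have "{y \<in> X - Q. f y = y} = {y \<in> X. f y = y}"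
      by auto
    moreover have "card X = card (X - Q) + p"
      using \<open>Q \<subseteq> X\<close> psubset.hyps cardQ card_mono[OF psubset.hyps \<open>Q \<subseteq> X\<close>]
      by (simp add: card_Diff_subset finite_subset)
    ultimately show ?thesis
      using IH by (simp add: cong_def)
  qed
qed

text \<open>The \<open>p\<close>-th power of \<open>f ^^ (p ^ e)\<close> is the identity on
  \<open>X\<close>, and \<open>f\<close> acts on the fixed points of this iterate with the smaller
  exponent \<open>e\<close>; the two congruences compose.\<close>

lemma card_cong_card_fixed_points:
  fixes f :: "'b \<Rightarrow> 'b"
  assumes "prime p" "finite X" "f ` X \<subseteq> X" "\<And>x. x \<in> X \<Longrightarrow> (f ^^ (p ^ e)) x = x"
  shows "[card X = card {x \<in> X. f x = x}] (mod p)"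
  using assms(2-4)
proof (induction e arbitrary: X)
  case 0
  then have "{x \<in> X. f x = x} = X"
    by auto
  then show ?case
    by simp
next
  case (Suc e)
  let ?g = "f ^^ (p ^ e)" and ?Y = "{x \<in> X. (f ^^ (p ^ e)) x = x}"
  have "(f ^^ n) ` X \<subseteq> X" for n
    using Suc.prems(2) by (induction n) auto
  moreover have "(?g ^^ p) x = x" if "x \<in> X" for x
    using Suc.prems(3)[OF that] by (simp add: funpow_mult mult.commute)
  ultimately have "[card X = card ?Y] (mod p)"
    using Suc.prems(1) by (intro card_cong_card_fixed_points_prime[OF assms(1)]) auto
  moreover have "[card ?Y = card {x \<in> ?Y. f x = x}] (mod p)"
    using Suc.prems(1,2) by (intro Suc.IH) (auto simp flip: funpow_swap1)
  moreover have "(f ^^ n) x = x" if "f x = x" for n x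
    using that by (induction n) simp_all
  then have "{x \<in> ?Y. f x = x} = {x \<in> X. f x = x}"
    by auto
  ultimately show ?case
    using cong_trans by fastforce
qed

subsection \<open>Subrings containing an element of order divisible by a primitive prime divisor\<close>

lemma primitive_prime_divisor_dvd_diff:
  assumes "primitive_prime_divisor p m" "i \<le> m" "p dvd 2 ^ i - 1" "i > 0"
  shows "i = m"
  using assms unfolding primitive_prime_divisor_def by (cases "i = m") auto

lemma card_additive_subgroup:
  fixes K :: "'a::{field,finite} set"
  assumes "CARD('a) = 2 ^ m" "0 \<in> K" "\<And>x y. x \<in> K \<Longrightarrow> y \<in> K \<Longrightarrow> x + y \<in> K"
  shows "\<exists>i\<le>m. card K = 2 ^ i"
proof -
  let ?G = "\<lparr>carrier = (UNIV :: 'a set), monoid.mult = (+), one = 0\<rparr>"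
  interpret G: group ?G
  proof (rule groupI)
    show "\<exists>y\<in>carrier ?G. y \<otimes>\<^bsub>?G\<^esub> x = \<one>\<^bsub>?G\<^esub>" for x
      by (intro bexI[of _ "- x"]) auto
  qed (auto simp: add_ac)
  have inv: "inv\<^bsub>?G\<^esub> x = - x" for x
    by (rule G.inv_equality) auto
  have "subgroup K ?G"
    using assms by (intro subgroup.intro) (auto simp: inv minus_eq_self[OF assms(1)])
  then have "card (rcosets\<^bsub>?G\<^esub> K) * card K = 2 ^ m"
    using G.lagrange[of K] assms(1) by (simp add: Coset.order_def)
  then have "card K dvd 2 ^ m"
    by (metis dvd_triv_right)
  then show ?thesis
    by (simp add: divides_primepow_nat[OF two_is_prime_nat])
qed

text \<open>Multiplication by \<open>b\<close> moves every nonzero element of \<open>K\<close> and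
  has \<open>p\<close>-power order, so \<open>p\<close> divides \<open>card K - 1\<close>. As
  \<open>card K\<close> is a power \<open>2^i\<close>, primitivity forces
  \<open>i = m\<close>.\<close>

lemma subring_eq_UNIV:
  fixes K :: "'a::{field,finite} set"
  assumes card: "CARD('a) = 2 ^ m" and ppd: "primitive_prime_divisor p m"
    and K: "0 \<in> K" "1 \<in> K" "\<And>x y. x \<in> K \<Longrightarrow> y \<in> K \<Longrightarrow> x + y \<in> K"
      "\<And>x y. x \<in> K \<Longrightarrow> y \<in> K \<Longrightarrow> x * y \<in> K"
    and b: "b \<in> K" "b \<noteq> 1" "b ^ (p ^ e) = 1"
  shows "K = UNIV"
proof -
  obtain i where i: "i \<le> m" "card K = 2 ^ i"
    using card_additive_subgroup[OF card K(1,3)] by blast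
  have pr: "prime p"
    using ppd by (simp add: primitive_prime_divisor_def)
  have b0: "b \<noteq> 0"
    using b pr by (auto simp: power_0_left prime_gt_0_nat split: if_splits)
  have pow: "(((*) b) ^^ n) x = b ^ n * x" for n x
    by (induction n) (simp_all add: mult_ac)
  have "[card (K - {0}) = card {x \<in> K - {0}. b * x = x}] (mod p)"
    using b K b0 by (intro card_cong_card_fixed_points[OF pr, where e = e]) (auto simp: pow)
  moreover have "{x \<in> K - {0}. b * x = x} = {}"
    using b by auto
  ultimately have "[card (K - {0}) = 0] (mod p)"
    by (simp only: card.empty)
  then have "p dvd 2 ^ i - 1"
    using i K(1) by (simp add: cong_0_iff card_Diff_singleton)
  \<comment> \<open>This case has to be excluded separately: \<open>2^0 - 1 = 0\<close> is divisible
    by \<open>p\<close>.\<close>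
  moreover have "i > 0"
  proof (rule ccontr)
    assume "\<not> i > 0"
    then have "card K = 1"
      using i by simp
    then show False
      using K(1,2) by (metis card_1_singletonE singletonD zero_neq_one)
  qed
  ultimately have "i = m"
    using primitive_prime_divisor_dvd_diff[OF ppd] i by blast
  then show ?thesis
    using i card by (metis card_subset_eq finite subset_UNIV)
qed

text \<open>The polynomial with roots \<open>b^(2^t)\<close>, \<open>t < m\<close>, is invariant
  under squaring its coefficients, so these are 0 or 1 and \<open>h\<close> fixes them. Hence
  \<open>h b\<close> is one of the roots, and \<open>h\<close> agrees with that Frobenius power on a
  subring containing \<open>b\<close>.\<close>

lemma field_automorphism_eq_frobenius:
  fixes h :: "'a::{field,finite} \<Rightarrow> 'a" and b :: 'a
  assumes card: "CARD('a) = 2 ^ m" and ppd: "primitive_prime_divisor p m"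
    and b: "b \<noteq> 1" "b ^ (p ^ e) = 1"
    and add: "\<And>x y. h (x + y) = h x + h y" and mult: "\<And>x y. h (x * y) = h x * h y"
    and one: "h 1 = 1"
  shows "\<exists>s<m. \<forall>x. h x = x ^ (2 ^ s)"
proof -
  have "m \<noteq> 0"
  proof
    assume "m = 0"
    then have "is_singleton (UNIV :: 'a set)"
      using card by (simp add: is_singleton_altdef)
    then show False
      by (metis UNIV_I is_singletonE singletonD zero_neq_one)
  qed
  define q where "q = (\<Prod>t<m. [:- (b ^ (2 ^ t)), 1:])"
  have qx: "poly q x = (\<Prod>t<m. x - b ^ (2 ^ t))" for x
    by (simp add: q_def poly_prod)
  have deg: "degree q = m"
    by (simp add: q_def degree_prod_sum_eq)
  have sq: "(x + y) ^ 2 = x ^ 2 + y ^ 2" for x y :: 'a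
    using frobenius_add[OF card, of x y 1] by simp
  have "(poly q x) ^ 2 = poly q (x ^ 2)" for x
  proof -
    have "(poly q x) ^ 2 = (\<Prod>t<m. (x - b ^ (2 ^ t)) ^ 2)"
      by (simp add: qx prod_power_distrib)
    also have "\<dots> = (\<Prod>t<m. x ^ 2 - b ^ (2 ^ Suc t))"
      using sq[of x "- _"]
      by (intro prod.cong) (simp_all add: diff_conv_add_uminus minus_eq_self[OF card] mult.commute
          del: add_uminus_conv_diff flip: power_mult)
    \<comment> \<open>Squaring shifts the factors cyclically, since
      \<open>b^(2^m) = b\<close>.\<close>
    also have "\<dots> = (\<Prod>t<m. x ^ 2 - b ^ (2 ^ t))"
    proof -
      obtain m' where m': "m = Suc m'"
        using \<open>m \<noteq> 0\<close> not0_implies_Suc by blast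
      have "b ^ (2 ^ Suc m') = b ^ (2 ^ 0)"
        using frobenius_mod[OF card, of b "Suc m'"] by (simp add: m')
      then show ?thesis
        unfolding m' by (subst prod.lessThan_Suc, subst prod.lessThan_Suc_shift) (simp add: mult_ac)
    qed
    finally show ?thesis
      by (simp add: qx)
  qed
  moreover have "(poly q x) ^ 2 = (\<Sum>j\<le>m. (Polynomial.coeff q j) ^ 2 * (x ^ 2) ^ j)" for x
    unfolding poly_altdef deg using frobenius_sum[OF card, of _ "{..m}" 1]
    by (simp add: power_mult_distrib mult.commute flip: power_mult)
  moreover have "poly q (x ^ 2) = (\<Sum>j\<le>m. Polynomial.coeff q j * (x ^ 2) ^ j)" for x
    by (simp add: poly_altdef deg)
  ultimately have eq: "(\<Sum>j\<le>m. ((Polynomial.coeff q j) ^ 2 - Polynomial.coeff q j) * (x ^ 2) ^ j) = 0" for x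
    by (simp add: left_diff_distrib sum_subtractf)
  \<comment> \<open>Every element of the field is a square, so this polynomial of degree at most
    \<open>m < 2^m\<close> vanishes at all \<open>2^m\<close> points.\<close>
  define r where "r = (\<Sum>j\<le>m. Polynomial.monom ((Polynomial.coeff q j) ^ 2 - Polynomial.coeff q j) j)"
  have "poly r x = 0" for x
  proof -
    have "(x ^ (2 ^ (m - 1))) ^ 2 = x ^ (2 ^ m)"
      using \<open>m \<noteq> 0\<close> by (metis power_mult power_minus_mult neq0_conv)
    then have "(x ^ (2 ^ (m - 1))) ^ 2 = x"
      using finite_field_power_card[of x] card by simp
    then show ?thesis
      using eq[of "x ^ (2 ^ (m - 1))"] by (simp add: r_def poly_sum poly_monom)
  qed
  then have "card {x. poly r x = 0} = 2 ^ m"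
    using card by simp
  moreover have "degree r < 2 ^ m"
  proof -
    have "degree r \<le> m"
      unfolding r_def by (intro degree_sum_le) (auto intro!: order_trans[OF degree_monom_le])
    also have "m < 2 ^ m"
      by simp
    finally show ?thesis .
  qed
  ultimately have "r = 0"
    using card_poly_roots_bound[of r] by force
  have coeffs: "Polynomial.coeff q j = 0 \<or> Polynomial.coeff q j = 1" for j
  proof (cases "j \<le> m")
    case True
    then have "Polynomial.coeff r j = (Polynomial.coeff q j) ^ 2 - Polynomial.coeff q j"
      by (simp add: r_def coeff_sum)
    then have "Polynomial.coeff q j * (Polynomial.coeff q j - 1) = 0"
      using \<open>r = 0\<close> by (simp add: power2_eq_square algebra_simps)
    then show ?thesis
      by simp
  qed (simp add: coeff_eq_0 deg)
  have zero: "h 0 = 0"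
    using add[of 0 0] by (metis add.left_neutral add_cancel_right_right)
  have pow: "h (x ^ n) = h x ^ n" for x n
    by (induction n) (simp_all add: one mult)
  have sum: "h (sum f A) = (\<Sum>x\<in>A. h (f x))" for f :: "nat \<Rightarrow> 'a" and A
    by (induction A rule: infinite_finite_induct) (simp_all add: zero add)
  have "h (Polynomial.coeff q j) = Polynomial.coeff q j" for j
    using coeffs[of j] zero one by auto
  then have "poly q (h b) = h (poly q b)"
    by (simp add: poly_altdef sum mult pow)
  moreover have "poly q b = 0"
    using \<open>m \<noteq> 0\<close> by (auto simp: qx intro!: bexI[of _ 0])
  ultimately have "(\<Prod>t<m. h b - b ^ (2 ^ t)) = 0"
    by (metis qx zero)
  then obtain s where s: "s < m" "h b = b ^ (2 ^ s)"
    by auto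
  have "{x. h x = x ^ (2 ^ s)} = UNIV"
    using s b
    by (intro subring_eq_UNIV[OF card ppd, where b = b and e = e])
       (auto simp: zero one add mult power_mult_distrib frobenius_add[OF card])
  then show ?thesis
    using s by blast
qed

text \<open>
  The scalars \<open>x\<close> for which \<open>T\<close> intertwines multiplication by \<open>x\<close> with a multiplication form a
  subring.
\<close>

lemma semilinear_imp_monomial:
  fixes T :: "'a::{field,finite} \<Rightarrow> 'a"
  assumes card: "CARD('a) = 2 ^ m" and ppd: "primitive_prime_divisor p m"
    and b: "b \<noteq> 1" "b ^ (p ^ e) = 1"
    and add: "\<And>x y. T (x + y) = T x + T y"
    and semi: "\<And>x. T (b * x) = z * T x"
    and nz: "T \<noteq> (\<lambda>_. 0)"
  shows "\<exists>s<m. monomial_of_degree s T \<and> z = b ^ (2 ^ s)"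
proof -
  obtain x0 where x0: "T x0 \<noteq> 0"
    using nz by auto
  have T0: "T 0 = 0"
    using add[of 0 0] by (metis add.left_neutral add_cancel_right_right)
  have "{x. \<exists>y. \<forall>u. T (x * u) = y * T u} = UNIV"
  proof (rule subring_eq_UNIV[OF card ppd])
    show "x + x' \<in> {x. \<exists>y. \<forall>u. T (x * u) = y * T u}"
      if x: "x \<in> {x. \<exists>y. \<forall>u. T (x * u) = y * T u}" "x' \<in> {x. \<exists>y. \<forall>u. T (x * u) = y * T u}" for x x'
    proof -
      obtain y y' where "\<forall>u. T (x * u) = y * T u" "\<forall>u. T (x' * u) = y' * T u"
        using x by auto
      then have "\<forall>u. T ((x + x') * u) = (y + y') * T u"
        by (simp add: distrib_right add)
      then show ?thesis
        by blast
    qed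
    show "x * x' \<in> {x. \<exists>y. \<forall>u. T (x * u) = y * T u}"
      if x: "x \<in> {x. \<exists>y. \<forall>u. T (x * u) = y * T u}" "x' \<in> {x. \<exists>y. \<forall>u. T (x * u) = y * T u}" for x x'
    proof -
      obtain y y' where "\<forall>u. T (x * u) = y * T u" "\<forall>u. T (x' * u) = y' * T u"
        using x by auto
      then have "\<forall>u. T ((x * x') * u) = (y * y') * T u"
        by (simp add: mult.assoc)
      then show ?thesis
        by blast
    qed
  qed (use b semi T0 in auto)
  then have "\<forall>x. \<exists>y. \<forall>u. T (x * u) = y * T u"
    by auto
  then obtain h where h: "\<And>x u. T (x * u) = h x * T u"
    by metis
  \<comment> \<open>Since \<open>T x0 \<noteq> 0\<close>, one value of \<open>T\<close> determines
    the multiplier \<open>h x\<close>; this is how the laws of a ring homomorphism pass to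
    \<open>h\<close>.\<close>
  have hx: "h x = y" if "T (x * x0) = y * T x0" for x y
    using that x0 by (simp add: h)
  have "\<exists>s<m. \<forall>x. h x = x ^ (2 ^ s)"
  proof (rule field_automorphism_eq_frobenius[OF card ppd b])
    show "h (x + y) = h x + h y" for x y
      by (rule hx) (simp add: distrib_right add h)
    show "h (x * y) = h x * h y" for x y
      by (rule hx) (simp add: mult.assoc h)
    show "h 1 = 1"
      by (rule hx) simp
  qed
  then obtain s where s: "s < m" "\<And>x. h x = x ^ (2 ^ s)"
    by blast
  have T: "T x = T 1 * x ^ (2 ^ s)" for x
    using h[of x 1] s by (simp add: mult.commute)
  then have "T 1 \<noteq> 0"
    using x0 by (metis mult_zero_left)
  moreover have "h b = z"
    by (rule hx) (simp add: semi)
  ultimately show ?thesis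
    using s T unfolding monomial_of_degree_def by blast
qed

subsection \<open>Conjugating elements into a Sylow subgroup\<close>

text \<open>The conjugators on the left form the left coset of the centralizer through
  \<open>k\<close>.\<close>

lemma (in group) card_conjugators:
  assumes "finite (carrier G)" "s \<in> carrier G" "k \<in> carrier G"
  shows "card {g \<in> carrier G. g \<otimes> s \<otimes> inv g = k \<otimes> s \<otimes> inv k} =
    card {g \<in> carrier G. g \<otimes> s = s \<otimes> g}"
proof -
  have "g \<otimes> s \<otimes> inv g = k \<otimes> s \<otimes> inv k \<longleftrightarrow> (inv k \<otimes> g) \<otimes> s = s \<otimes> (inv k \<otimes> g)"
    if "g \<in> carrier G" for g
  proof -
    have "g \<otimes> s \<otimes> inv g = k \<otimes> s \<otimes> inv k \<longleftrightarrow> g \<otimes> s = k \<otimes> s \<otimes> inv k \<otimes> g"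
      using that assms by (metis inv_closed inv_solve_right m_closed)
    also have "\<dots> \<longleftrightarrow> inv k \<otimes> (g \<otimes> s) = s \<otimes> inv k \<otimes> g"
      using that assms by (metis inv_closed inv_solve_left m_assoc m_closed)
    finally show ?thesis
      using that assms by (simp add: m_assoc)
  qed
  moreover have "inv k \<otimes> (k \<otimes> h) = h" "k \<otimes> (inv k \<otimes> h) = h" if "h \<in> carrier G" for h
    using that assms by (simp_all flip: m_assoc)
  ultimately have "bij_betw (\<lambda>g. inv k \<otimes> g) {g \<in> carrier G. g \<otimes> s \<otimes> inv g = k \<otimes> s \<otimes> inv k}
      {g \<in> carrier G. g \<otimes> s = s \<otimes> g}"
    using assms
    by (intro bij_betw_byWitness[where f' = "\<lambda>g. k \<otimes> g"]) auto
  then show ?thesis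
    by (rule bij_betw_same_card)
qed

lemma (in group) rcos_mult_eq_iff:
  assumes "subgroup S G" "g \<in> carrier G" "c \<in> carrier G"
  shows "(S #> g) #> c = S #> g \<longleftrightarrow> g \<otimes> c \<otimes> inv g \<in> S"
proof -
  have sub: "S \<subseteq> carrier G"
    using assms(1) by (rule subgroup.subset)
  have "(S #> g) #> c = S #> g \<longleftrightarrow> S #> (g \<otimes> c) = S #> g"
    using assms sub by (simp add: coset_mult_assoc)
  also have "\<dots> \<longleftrightarrow> S #> (g \<otimes> c \<otimes> inv g) = S"
    using assms sub by (metis coset_mult_inv1 coset_mult_inv2 inv_closed m_closed)
  also have "\<dots> \<longleftrightarrow> g \<otimes> c \<otimes> inv g \<in> S"
    using assms sub coset_join1 coset_join2 by (metis inv_closed m_closed)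
  finally show ?thesis .
qed

lemma (in group) card_rcosets_cong_fixed:
  assumes "finite (carrier G)" "prime p" "subgroup S G"
    and c: "c \<in> carrier G" "c [^] (p ^ e) = \<one>"
  shows "[card (rcosets S) = card {A \<in> rcosets S. A #> c = A}] (mod p)"
proof (rule card_cong_card_fixed_points[OF assms(2)])
  have sub: "S \<subseteq> carrier G"
    using assms(3) by (rule subgroup.subset)
  have sub': "A \<subseteq> carrier G" if "A \<in> rcosets S" for A
    using subgroup.rcosets_carrier[OF assms(3) is_group that] .
  show "finite (rcosets S)"
    using assms(1) rcosets_part_G[OF assms(3)] by (metis finite_UnionD)
  show "(\<lambda>A. A #> c) ` (rcosets S) \<subseteq> rcosets S"
    using c sub by (auto simp: RCOSETS_def coset_mult_assoc)
  show "((\<lambda>A. A #> c) ^^ (p ^ e)) A = A" if "A \<in> rcosets S" for A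
  proof -
    have "((\<lambda>A. A #> c) ^^ n) A = A #> (c [^] n)" for n
      using c sub'[OF that] by (induction n) (simp_all add: coset_mult_assoc)
    then show ?thesis
      using c sub'[OF that] by simp
  qed
qed

text \<open>
  \<open>\<sigma>\<close> fixes the coset \<open>S g\<close> iff \<open>g \<sigma> g\<^sup>-\<^sup>1 \<in> S\<close>. Such \<open>g\<close> form as many cosets of the centralizer of
  \<open>\<sigma>\<close> as \<open>\<sigma>\<close> has conjugates in \<open>S\<close>, so their number has the same \<open>p\<close>-part as \<open>S\<close>; hence \<open>p\<close> does not
  divide the index of \<open>S\<close>, and \<open>\<tau>\<close> fixes a coset as well.
\<close>

lemma (in group) conjugate_into_sylow:
  assumes fin: "finite (carrier G)" and p: "prime p"
    and S: "subgroup S G" "card S = p ^ e"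
    and \<sigma>: "\<sigma> \<in> S" "\<sigma> [^] (p ^ e) = \<one>"
    and C: "card {g \<in> carrier G. g \<otimes> \<sigma> = \<sigma> \<otimes> g} = p ^ e * n" "\<not> p dvd n"
    and B: "card {x \<in> S. \<exists>g\<in>carrier G. x = g \<otimes> \<sigma> \<otimes> inv g} < p"
    and \<tau>: "\<tau> \<in> carrier G" "\<tau> [^] (p ^ e) = \<one>"
  shows "\<exists>g\<in>carrier G. g \<otimes> \<tau> \<otimes> inv g \<in> S"
proof -
  let ?B = "{x \<in> S. \<exists>g\<in>carrier G. x = g \<otimes> \<sigma> \<otimes> inv g}"
  define N where "N = {g \<in> carrier G. g \<otimes> \<sigma> \<otimes> inv g \<in> S}"
  have sub: "S \<subseteq> carrier G"
    using S(1) by (rule subgroup.subset)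
  then have \<sigma>G: "\<sigma> \<in> carrier G"
    using \<sigma> by auto
  have finB: "finite ?B"
    using finite_subset[OF sub fin] by simp
  have "N = (\<Union>x\<in>?B. {g \<in> carrier G. g \<otimes> \<sigma> \<otimes> inv g = x})"
    by (auto simp: N_def)
  then have "card N = (\<Sum>x\<in>?B. card {g \<in> carrier G. g \<otimes> \<sigma> \<otimes> inv g = x})"
    using fin finB by (auto intro!: card_UN_disjoint)
  also have "\<dots> = (\<Sum>x\<in>?B. p ^ e * n)"
    using card_conjugators[OF fin \<sigma>G] C(1) by (intro sum.cong) auto
  finally have cardN: "card N = p ^ e * (card ?B * n)"
    by simp
  let ?F = "{A \<in> rcosets S. A #> \<sigma> = A}"
  have F: "?F = (\<lambda>g. S #> g) ` N"
    using rcos_mult_eq_iff[OF S(1) _ \<sigma>G] by (auto simp: RCOSETS_def N_def)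
  \<comment> \<open>The fixed cosets partition \<open>N\<close> into pieces of size
    \<open>p ^ e\<close>, which cancels against the \<open>p ^ e\<close> in the order of the
    centralizer.\<close>
  have "\<Union>?F = N"
  proof
    show "N \<subseteq> \<Union>?F"
      unfolding F using rcos_self[OF _ S(1)] by (auto simp: N_def)
    show "\<Union>?F \<subseteq> N"
    proof
      fix x
      assume "x \<in> \<Union>?F"
      then obtain g where g: "g \<in> N" "x \<in> S #> g"
        unfolding F by auto
      then have "S #> x = S #> g"
        using repr_independence[OF g(2) _ S(1)] by (simp add: N_def)
      moreover have "x \<in> carrier G"
        using g r_coset_subset_G[OF sub] by (auto simp: N_def)
      ultimately show "x \<in> N"
        using g rcos_mult_eq_iff[OF S(1) _ \<sigma>G] unfolding N_def by (metis (mono_tags, lifting) mem_Collect_eq)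
    qed
  qed
  moreover have "p ^ e * card ?F = card (\<Union>?F)"
  proof (rule card_partition)
    have "finite (rcosets S)"
      using fin rcosets_part_G[OF S(1)] by (metis finite_UnionD)
    then show "finite ?F"
      by simp
    show "finite (\<Union>?F)"
      using \<open>\<Union>?F = N\<close> fin by (simp add: N_def)
    show "card A = p ^ e" if "A \<in> ?F" for A
      using that card_rcosets_equal[OF _ sub] S(2) by auto
    show "A \<inter> A' = {}" if "A \<in> ?F" "A' \<in> ?F" "A \<noteq> A'" for A A'
      using that rcos_disjoint[OF S(1)] by (auto simp: pairwise_def disjnt_def)
  qed
  ultimately have "card ?F = card ?B * n"
    using cardN p by (simp add: prime_gt_0_nat)
  \<comment> \<open>\<open>card ?B\<close> lies strictly between 0 and \<open>p\<close>, the lower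
    bound because \<open>\<sigma>\<close> is its own conjugate.\<close>
  moreover have "\<sigma> \<in> ?B"
    using \<sigma> \<sigma>G by (auto intro!: bexI[of _ \<one>])
  then have "card ?B \<noteq> 0"
    using finB by auto
  then have "\<not> p dvd card ?B"
    using B by (meson dvd_imp_le leD neq0_conv)
  ultimately have "\<not> p dvd card ?F"
    using C(2) p prime_dvd_mult_nat by presburger
  then have "\<not> p dvd card (rcosets S)"
    using card_rcosets_cong_fixed[OF fin p S(1) \<sigma>G \<sigma>(2)] cong_dvd_iff by blast
  then have "\<not> p dvd card {A \<in> rcosets S. A #> \<tau> = A}"
    using card_rcosets_cong_fixed[OF fin p S(1) \<tau>] cong_dvd_iff by blast
  then have "{A \<in> rcosets S. A #> \<tau> = A} \<noteq> {}"
    by (metis card.empty dvd_0_right)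
  then obtain g where "g \<in> carrier G" "(S #> g) #> \<tau> = S #> g"
    by (auto simp: RCOSETS_def)
  then show ?thesis
    using rcos_mult_eq_iff[OF S(1) _ \<tau>(1)] by blast
qed

subsection \<open>The group ELM\<close>

lemma additive_diff:
  fixes T :: "'v::ab_group_add \<Rightarrow> 'w::ab_group_add"
  assumes "\<And>x y. T (x + y) = T x + T y"
  shows "T 0 = 0" "T (x - y) = T x - T y"
proof -
  show "T 0 = 0"
    using assms[of 0 0] by simp
  show "T (x - y) = T x - T y"
    using assms[of "x - y" y] by simp
qed

lemma vector_space_F2_scale:
  assumes "\<And>v::'v::ab_group_add. v + v = 0"
  shows "vector_space (F2_scale :: bit \<Rightarrow> 'v \<Rightarrow> 'v)"
proof
  have bit: "a = 0 \<or> a = 1" for a :: bit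
    by (cases a) simp_all
  fix a b :: bit and x y :: 'v
  show "F2_scale a (x + y) = F2_scale a x + F2_scale a y"
    "F2_scale a (F2_scale b x) = F2_scale (a * b) x" "F2_scale 1 x = x"
    by (simp_all add: F2_scale_def)
  show "F2_scale (a + b) x = F2_scale a x + F2_scale b x"
    using bit[of a] bit[of b] assms[of x] by (auto simp: F2_scale_def)
qed

lemma F2_linear_iff_additive:
  fixes T :: "'v::ab_group_add \<Rightarrow> 'w::ab_group_add"
  assumes "\<And>v::'v. v + v = 0" "\<And>w::'w. w + w = 0"
  shows "F2_linear T \<longleftrightarrow> (\<forall>x y. T (x + y) = T x + T y)"
proof -
  have "vector_space (F2_scale :: bit \<Rightarrow> 'v \<Rightarrow> 'v)" "vector_space (F2_scale :: bit \<Rightarrow> 'w \<Rightarrow> 'w)"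
    using assms by (simp_all add: vector_space_F2_scale)
  moreover have "T (F2_scale c x) = F2_scale c (T x)" if "\<forall>x y. T (x + y) = T x + T y" for c x
    using additive_diff(1)[of T] that by (simp add: F2_scale_def)
  ultimately show ?thesis
    unfolding F2_linear_def Vector_Spaces.linear_iff by blast
qed

text \<open>Block-triangular means that the second summand is mapped into itself. In this form
  composites and inverses need no block arithmetic.\<close>

lemma ELM_iff:
  fixes \<gamma> :: "'v::ab_group_add \<times> 'v \<Rightarrow> 'v \<times> 'v"
  assumes char2: "\<And>v::'v. v + v = 0"
  shows "\<gamma> \<in> ELM \<longleftrightarrow> (\<forall>x y. \<gamma> (x + y) = \<gamma> x + \<gamma> y) \<and> bij \<gamma> \<and> (\<forall>w. fst (\<gamma> (0, w)) = 0)"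
    (is "_ \<longleftrightarrow> ?R")
proof -
  have char2': "v + v = 0" for v :: "'v \<times> 'v"
    by (cases v) (simp add: char2 zero_prod_def)
  note lin = F2_linear_iff_additive[OF char2 char2, simp] F2_linear_iff_additive[OF char2' char2', simp]
  show ?thesis
  proof
    assume "\<gamma> \<in> ELM"
    then obtain M N L where "\<forall>x y. \<gamma> (x + y) = \<gamma> x + \<gamma> y" "bij \<gamma>"
      "F2_linear M" and \<gamma>: "\<gamma> = block M (\<lambda>_. 0) N L"
      unfolding ELM_def GL_def by auto
    then show ?R
      using additive_diff(1)[of M] by (simp add: block_def)
  next
    assume R: ?R
    define M where "M = (\<lambda>z. fst (\<gamma> (z, 0)))"
    define N where "N = (\<lambda>z. snd (\<gamma> (z, 0)))"
    define L where "L = (\<lambda>z. snd (\<gamma> (0, z)))"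
    have add: "\<gamma> (x + y) = \<gamma> x + \<gamma> y" for x y
      using R by blast
    have \<gamma>: "\<gamma> (z, w) = \<gamma> (z, 0) + \<gamma> (0, w)" for z w
      using add[of "(z, 0)" "(0, w)"] by simp
    have "\<gamma> (z, w) = block M (\<lambda>_. 0) N L (z, w)" for z w
      unfolding \<gamma>[of z w] using R by (simp add: block_def M_def N_def L_def prod_eq_iff)
    then have "\<gamma> = block M (\<lambda>_. 0) N L"
      by (simp add: fun_eq_iff)
    moreover have "F2_linear M" "F2_linear N" "F2_linear L"
      using add[of "(_, 0)" "(_, 0)"] add[of "(0, _)" "(0, _)"]
      by (simp_all add: M_def N_def L_def)
    ultimately show "\<gamma> \<in> ELM"
      using R unfolding ELM_def GL_def by auto
  qed
qed

lemma ELM_comp: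
  fixes \<gamma> \<delta> :: "'v::ab_group_add \<times> 'v \<Rightarrow> 'v \<times> 'v"
  assumes char2: "\<And>v::'v. v + v = 0" and "\<gamma> \<in> ELM" "\<delta> \<in> ELM"
  shows "\<gamma> \<circ> \<delta> \<in> ELM"
proof -
  have "\<delta> (0, w) = (0, snd (\<delta> (0, w)))" for w
    using assms by (simp add: ELM_iff[OF char2] prod_eq_iff)
  then show ?thesis
    using assms bij_comp[of \<delta> \<gamma>] unfolding ELM_iff[OF char2] comp_apply by metis
qed

lemma ELM_inv_into:
  fixes \<gamma> :: "'v::{ab_group_add,finite} \<times> 'v \<Rightarrow> 'v \<times> 'v"
  assumes char2: "\<And>v::'v. v + v = 0" and "\<gamma> \<in> ELM"
  shows "inv_into UNIV \<gamma> \<in> ELM"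
proof -
  have add: "\<gamma> (x + y) = \<gamma> x + \<gamma> y" and bij: "bij \<gamma>" and zero: "fst (\<gamma> (0, w)) = 0" for x y w
    using assms unfolding ELM_iff[OF char2] by blast+
  have "inv_into UNIV \<gamma> (x + y) = inv_into UNIV \<gamma> x + inv_into UNIV \<gamma> y" for x y
    using add bij by (metis bij_inv_eq_iff)
  moreover have "fst (inv_into UNIV \<gamma> (0, w)) = 0" for w
  proof -
    \<comment> \<open>The second summand is mapped injectively into itself, hence onto itself by
      finiteness; so the inverse preserves it as well.\<close>
    have "inj (\<lambda>w. snd (\<gamma> (0, w)))"
    proof (rule injI)
      fix w w'
      assume "snd (\<gamma> (0, w)) = snd (\<gamma> (0, w'))"
      then have "\<gamma> (0, w) = \<gamma> (0, w')"
        using zero by (simp add: prod_eq_iff)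
      then show "w = w'"
        using bij by (simp add: bij_def inj_eq)
    qed
    then have "surj (\<lambda>w. snd (\<gamma> (0, w)))"
      by (simp add: finite_UNIV_inj_surj)
    then obtain w' where "snd (\<gamma> (0, w')) = w"
      using surjD[of "\<lambda>w. snd (\<gamma> (0, w))" w] by auto
    then have "\<gamma> (0, w') = (0, w)"
      using zero by (simp add: prod_eq_iff)
    then show ?thesis
      using bij by (metis bij_inv_eq_iff fst_conv)
  qed
  ultimately show ?thesis
    using bij by (simp add: ELM_iff[OF char2] bij_imp_bij_inv)
qed

lemma id_in_ELM:
  assumes "\<And>v::'v::ab_group_add. v + v = 0"
  shows "(id :: 'v \<times> 'v \<Rightarrow> 'v \<times> 'v) \<in> ELM"
  using assms by (simp add: ELM_iff)

lemma group_ELM_group: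
  assumes char2: "\<And>v::'v::{ab_group_add,finite}. v + v = 0"
  shows "group (ELM_group :: ('v \<times> 'v \<Rightarrow> 'v \<times> 'v) monoid)"
proof (rule groupI)
  fix \<gamma> :: "'v \<times> 'v \<Rightarrow> 'v \<times> 'v"
  assume "\<gamma> \<in> carrier ELM_group"
  then have "\<gamma> \<in> ELM"
    by (simp add: ELM_group_def)
  moreover from this have "inj \<gamma>"
    by (simp add: ELM_iff[OF char2] bij_def)
  ultimately show "\<exists>\<delta>\<in>carrier ELM_group. \<delta> \<otimes>\<^bsub>ELM_group\<^esub> \<gamma> = \<one>\<^bsub>ELM_group\<^esub>"
    using ELM_inv_into[OF char2]
    by (intro bexI[of _ "inv_into UNIV \<gamma>"]) (simp_all add: ELM_group_def)
qed (auto simp: ELM_group_def ELM_comp[OF char2] id_in_ELM[OF char2] comp_assoc)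

lemma inv_ELM_group:
  fixes \<gamma> :: "'v::{ab_group_add,finite} \<times> 'v \<Rightarrow> 'v \<times> 'v"
  assumes char2: "\<And>v::'v. v + v = 0" and "\<gamma> \<in> ELM"
  shows "inv\<^bsub>ELM_group\<^esub> \<gamma> = inv_into UNIV \<gamma>"
proof -
  have "inj \<gamma>"
    using assms by (simp add: ELM_iff[OF char2] bij_def)
  then show ?thesis
    using assms ELM_inv_into[OF assms]
    by (intro group.inv_equality[OF group_ELM_group[OF char2]]) (simp_all add: ELM_group_def)
qed

lemma subgroup_Aut_EL:
  fixes F :: "'v::{ab_group_add,finite} \<Rightarrow> 'v"
  assumes char2: "\<And>v::'v. v + v = 0"
  shows "subgroup (Aut_EL F) ELM_group"
proof (rule subgroup.intro)
  fix \<gamma> :: "'v \<times> 'v \<Rightarrow> 'v \<times> 'v"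
  assume "\<gamma> \<in> Aut_EL F"
  then have \<gamma>: "\<gamma> \<in> ELM" "\<gamma> ` graph_of F = graph_of F"
    by (simp_all add: Aut_EL_def)
  then have "inj \<gamma>"
    by (simp add: ELM_iff[OF char2] bij_def)
  then have "inv_into UNIV \<gamma> ` graph_of F = graph_of F"
    using \<gamma>(2) by (metis image_inv_f_f)
  then show "inv\<^bsub>ELM_group\<^esub> \<gamma> \<in> Aut_EL F"
    using ELM_inv_into[OF char2 \<gamma>(1)] by (simp add: inv_ELM_group[OF char2 \<gamma>(1)] Aut_EL_def)
next
  fix \<gamma> \<delta> :: "'v \<times> 'v \<Rightarrow> 'v \<times> 'v"
  assume "\<gamma> \<in> Aut_EL F" "\<delta> \<in> Aut_EL F"
  moreover from this have "(\<gamma> \<circ> \<delta>) ` graph_of F = graph_of F"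
    unfolding Aut_EL_def image_comp[symmetric] by simp
  ultimately show "\<gamma> \<otimes>\<^bsub>ELM_group\<^esub> \<delta> \<in> Aut_EL F"
    by (simp add: Aut_EL_def ELM_group_def ELM_comp[OF char2])
qed (auto simp: Aut_EL_def ELM_group_def id_in_ELM[OF char2])

text \<open>All graphs have the same finite cardinality and \<open>\<gamma>\<close> is injective, so
  inclusion of the image suffices. This turns equivalences into functional equations.\<close>

lemma image_graph_of_eq_iff:
  fixes \<gamma> :: "'v::{ab_group_add,finite} \<times> 'v \<Rightarrow> 'v \<times> 'v"
  assumes char2: "\<And>v::'v. v + v = 0" and "\<gamma> \<in> ELM"
  shows "\<gamma> ` graph_of F = graph_of G \<longleftrightarrow> (\<forall>z. snd (\<gamma> (z, F z)) = G (fst (\<gamma> (z, F z))))"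
proof -
  have "inj \<gamma>"
    using assms by (simp add: ELM_iff[OF char2] bij_def)
  have graph: "graph_of H = (\<lambda>z. (z, H z)) ` UNIV" for H :: "'v \<Rightarrow> 'v"
    by (auto simp: graph_of_def)
  have card: "card (graph_of H) = CARD('v)" for H :: "'v \<Rightarrow> 'v"
    unfolding graph by (rule card_image) (auto intro: inj_onI)
  have "\<gamma> ` graph_of F = graph_of G \<longleftrightarrow> \<gamma> ` graph_of F \<subseteq> graph_of G"
    using card card_image[OF inj_on_subset[OF \<open>inj \<gamma>\<close> subset_UNIV]]
    by (metis card_subset_eq finite subset_refl)
  also have "\<dots> \<longleftrightarrow> (\<forall>z. snd (\<gamma> (z, F z)) = G (fst (\<gamma> (z, F z))))"
    by (auto simp: graph image_subset_iff image_iff prod_eq_iff)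
  finally show ?thesis .
qed

subsection \<open>Polarization of biprojective forms\<close>

definition biform :: "nat \<Rightarrow> ('a::field \<times> 'a \<Rightarrow> 'a) \<Rightarrow> bool" where
  "biform q f \<longleftrightarrow> (\<exists>a b c d. \<forall>x y.
     f (x, y) = a * x^(q+1) + b * x^q * y + c * x * y^q + d * y^(q+1))"

definition scale_pair :: "'a::field \<Rightarrow> 'a \<times> 'a \<Rightarrow> 'a \<times> 'a" where
  "scale_pair u z = (u * fst z, u * snd z)"

text \<open>It vanishes identically exactly for additive maps, so additive summands such as
  \<open>N\<close> disappear from polarized equations.\<close>

definition polar :: "('v::ab_group_add \<Rightarrow> 'w::ab_group_add) \<Rightarrow> 'v \<Rightarrow> 'v \<Rightarrow> 'w" where
  "polar f z w = f (z + w) - f z - f w"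

lemma biprojective_imp_biform:
  assumes "biprojective q r F"
  shows "biform q (\<lambda>z. fst (F z))" "biform r (\<lambda>z. snd (F z))"
  using assms unfolding biprojective_def biform_def by force+

lemma biform_scale_pair:
  assumes "biform q f"
  shows "f (scale_pair u z) = u ^ (q + 1) * f z"
proof -
  obtain a b c d where f: "\<And>x y. f (x, y) = a * x^(q+1) + b * x^q * y + c * x * y^q + d * y^(q+1)"
    using assms unfolding biform_def by blast
  show ?thesis
    by (cases z) (simp add: f scale_pair_def algebra_simps power_mult_distrib)
qed

lemma biform_polar:
  fixes f :: "'a::{field,finite} \<times> 'a \<Rightarrow> 'a"
  assumes card: "CARD('a) = 2 ^ m" and "biform (2 ^ k) f"
  obtains A where "\<And>z w u v. polar f (scale_pair u z) (scale_pair v w) =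
    A z w * u ^ (2 ^ k) * v + A w z * u * v ^ (2 ^ k)"
proof -
  let ?q = "2 ^ k :: nat"
  obtain a b c d where
    f: "\<And>x y. f (x, y) = a * x^(?q+1) + b * x^?q * y + c * x * y^?q + d * y^(?q+1)"
    using assms unfolding biform_def by blast
  \<comment> \<open>The form with the \<open>q\<close>-th powers taken from \<open>z\<close> and the
    first powers from \<open>w\<close>, so that \<open>A z z = f z\<close>.\<close>
  define A :: "'a \<times> 'a \<Rightarrow> 'a \<times> 'a \<Rightarrow> 'a" where
    "A z w = a * fst z ^ ?q * fst w + b * fst z ^ ?q * snd w + c * fst w * snd z ^ ?q + d * snd z ^ ?q * snd w"
    for z w
  show ?thesis
  proof (rule that[of A])
    fix z w :: "'a \<times> 'a" and u v :: 'a
    show "polar f (scale_pair u z) (scale_pair v w) = A z w * u ^ ?q * v + A w z * u * v ^ ?q"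
      by (cases z; cases w)
         (simp add: polar_def f scale_pair_def A_def frobenius_add[OF card] algebra_simps power_mult_distrib)
  qed
qed

text \<open>The unordered pairs \<open>{k + s, s}\<close> and \<open>{k' + t, t}\<close> agree
  modulo \<open>m\<close>. They describe \<open>(x^(2^k + 1))^(2^s)\<close> and
  \<open>(x^(2^t))^(2^k' + 1)\<close> as products of two Frobenius powers of
  \<open>x\<close>.\<close>

definition same_exponents :: "nat \<Rightarrow> nat \<Rightarrow> nat \<Rightarrow> nat \<Rightarrow> nat \<Rightarrow> bool" where
  "same_exponents m k s k' t \<longleftrightarrow>
     [k + s = k' + t] (mod m) \<and> [s = t] (mod m) \<or> [k + s = t] (mod m) \<and> [s = k' + t] (mod m)"

lemma cong_nat_iff_dvd: "[a = b] (mod m) \<longleftrightarrow> int m dvd int a - int b"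
  by (metis cong_iff_dvd_diff cong_int_iff)

text \<open>Polarizing removes \<open>N\<close>. At the exponents \<open>k + s\<close> and
  \<open>s\<close> of the term in \<open>f\<close>, a contribution of \<open>g\<close> would force
  \<open>k\<close> to be \<open>l\<close> or \<open>-l\<close> modulo \<open>m\<close>; if
  \<open>h\<close> contributed nothing either, the polar form of \<open>f\<close> would
  vanish.\<close>

lemma same_exponents_of_equation:
  fixes f g h :: "'a::{field,finite} \<times> 'a \<Rightarrow> 'a"
  assumes card: "CARD('a) = 2 ^ m" and "m > 0"
    and f: "biform (2 ^ k) f" and g: "biform (2 ^ l) g" and h: "biform (2 ^ k') h"
    and kl: "\<not> [k = l] (mod m)" "\<not> [k + l = 0] (mod m)"
    and nonadd: "polar f z w \<noteq> 0"
    and M: "\<And>z w. M (z + w) = M z + M w" "\<And>u z. M (scale_pair u z) = scale_pair (u ^ (2 ^ t)) (M z)"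
    and N: "\<And>z w. N (z + w) = N z + N w"
    and eq: "\<And>z. h (M z) = N z + c * f z ^ (2 ^ s) + d * g z ^ (2 ^ s')"
    and c: "c \<noteq> 0"
  shows "same_exponents m k s k' t"
proof (rule ccontr)
  assume contr: "\<not> ?thesis"
  obtain A where A: "\<And>z w u v. polar f (scale_pair u z) (scale_pair v w) =
      A z w * u ^ (2 ^ k) * v + A w z * u * v ^ (2 ^ k)"
    using biform_polar[OF card f] by blast
  obtain B where B: "\<And>z w u v. polar g (scale_pair u z) (scale_pair v w) =
      B z w * u ^ (2 ^ l) * v + B w z * u * v ^ (2 ^ l)"
    using biform_polar[OF card g] by blast
  obtain H where H: "\<And>z w u v. polar h (scale_pair u z) (scale_pair v w) =
      H z w * u ^ (2 ^ k') * v + H w z * u * v ^ (2 ^ k')"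
    using biform_polar[OF card h] by blast
  have frob_diff: "(x - y) ^ (2 ^ i) = x ^ (2 ^ i) - y ^ (2 ^ i)" for x y :: 'a and i
    using frobenius_add[OF card, of "x - y" y i] by (simp add: algebra_simps)
  have polar: "polar h (M z) (M w) = c * polar f z w ^ (2 ^ s) + d * polar g z w ^ (2 ^ s')" for z w
    using eq[of "z + w"] eq[of z] eq[of w]
    unfolding polar_def frob_diff right_diff_distrib M N by simp
  define xs where "xs = [(c * A z w ^ (2 ^ s), k + s, s), (c * A w z ^ (2 ^ s), s, k + s),
    (d * B z w ^ (2 ^ s'), l + s', s'), (d * B w z ^ (2 ^ s'), s', l + s'),
    (- H (M z) (M w), k' + t, t), (- H (M w) (M z), t, k' + t)]"
  have "(\<Sum>(c, a, b)\<leftarrow>xs. c * u ^ (2 ^ a) * v ^ (2 ^ b)) = 0" for u v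
    using polar[of "scale_pair u z" "scale_pair v w"]
    by (simp add: xs_def M A B H frobenius_add[OF card] power_mult_distrib power_add mult_ac
        flip: power_mult) (simp add: algebra_simps)
  note coeff = bilinearized_polynomial_eq_0[OF card \<open>m > 0\<close> this]
  have 1: "\<not> ([l + s' = k + s] (mod m) \<and> [s' = s] (mod m))"
    using kl(1) dvd_diff[of "int m" "int s' - int s" "int (l + s') - int (k + s)"]
    unfolding cong_nat_iff_dvd by (auto simp: algebra_simps)
  have 2: "\<not> ([s' = k + s] (mod m) \<and> [l + s' = s] (mod m))"
    using kl(2) dvd_diff[of "int m" "int (l + s') - int s" "int s' - int (k + s)"]
    unfolding cong_nat_iff_dvd by (auto simp: algebra_simps)
  have 3: "\<not> ([k' + t = k + s] (mod m) \<and> [t = s] (mod m))" "\<not> ([t = k + s] (mod m) \<and> [k' + t = s] (mod m))"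
    using contr unfolding same_exponents_def by (meson cong_sym)+
  have 4: "[s = k + s] (mod m) \<and> [k + s = s] (mod m) \<longleftrightarrow> [k + s = s] (mod m)"
    "[k + s = s] (mod m) \<and> [s = k + s] (mod m) \<longleftrightarrow> [k + s = s] (mod m)"
    by (meson cong_sym)+
  \<comment> \<open>The conditional summand is present only for \<open>k = 0\<close> modulo
    \<open>m\<close>, where both terms of \<open>f\<close> share one exponent pair. Then
    \<open>s1\<close> alone gives the sum; otherwise \<open>s1\<close> and \<open>s2\<close> kill
    the two terms separately.\<close>
  have s1: "c * A z w ^ (2 ^ s) + (if [k + s = s] (mod m) then c * A w z ^ (2 ^ s) else 0) = 0"
    using coeff[of "k + s" s]
    unfolding xs_def list.map sum_list.Cons sum_list.Nil prod.case 4
      if_not_P[OF 1] if_not_P[OF 2] if_not_P[OF 3(1)] if_not_P[OF 3(2)] by simp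
  have s2: "(if [k + s = s] (mod m) then c * A z w ^ (2 ^ s) else 0) + c * A w z ^ (2 ^ s) = 0"
    using coeff[of s "k + s"]
    unfolding xs_def list.map sum_list.Cons sum_list.Nil prod.case 4
      if_not_P[OF 1[unfolded conj_commute[of "[l + s' = k + s] (mod m)"]]]
      if_not_P[OF 2[unfolded conj_commute[of "[s' = k + s] (mod m)"]]]
      if_not_P[OF 3(1)[unfolded conj_commute[of "[k' + t = k + s] (mod m)"]]]
      if_not_P[OF 3(2)[unfolded conj_commute[of "[t = k + s] (mod m)"]]] by simp
  have "c * (A z w + A w z) ^ (2 ^ s) = 0"
    using s1 s2 by (cases "[k + s = s] (mod m)") (auto simp: frobenius_add[OF card] distrib_left)
  moreover have "polar f z w = A z w + A w z"
    using A[of 1 z 1 w] by (simp add: scale_pair_def)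
  ultimately show False
    using c nonadd by simp
qed

text \<open>By homogeneity \<open>h (M z)\<close> and the term in \<open>f\<close> scale by the same
  factor in \<open>u\<close>, hence so does \<open>N\<close>. But \<open>N\<close> is additive, so
  the cross terms of this factor at \<open>u + v\<close>, which carry the coefficient
  \<open>N z\<close>, must vanish. They are distinct because \<open>k'\<close> is nonzero modulo
  \<open>m\<close> along with \<open>k\<close>.\<close>

lemma additive_part_eq_0:
  fixes f h :: "'a::{field,finite} \<times> 'a \<Rightarrow> 'a"
  assumes card: "CARD('a) = 2 ^ m" and "m > 0"
    and f: "biform (2 ^ k) f" and h: "biform (2 ^ k') h"
    and k: "\<not> [k = 0] (mod m)"
    and M: "\<And>u z. M (scale_pair u z) = scale_pair (u ^ (2 ^ t)) (M z)"
    and N: "\<And>z w. N (z + w) = N z + N w"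
    and eq: "\<And>z. h (M z) = N z + c * f z ^ (2 ^ s)"
    and exps: "same_exponents m k s k' t"
  shows "N z = 0"
proof -
  have frob: "u ^ (2 ^ i) = u ^ (2 ^ j)" if "[i = j] (mod m)" for u :: 'a and i j
    using that frobenius_mod[OF card] by (metis cong_def)
  have exp: "u ^ (2 ^ (k + s)) * u ^ (2 ^ s) = u ^ (2 ^ (k' + t)) * u ^ (2 ^ t)" for u :: 'a
    using exps frob[of "k + s" "k' + t" u] frob[of s t u] frob[of "k + s" t u] frob[of s "k' + t" u]
    unfolding same_exponents_def by auto
  have Nu: "N (scale_pair u z) = u ^ (2 ^ (k' + t)) * u ^ (2 ^ t) * N z" for u
  proof -
    have 1: "h (M (scale_pair u z)) = u ^ (2 ^ (k' + t)) * u ^ (2 ^ t) * h (M z)"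
      by (simp add: M biform_scale_pair[OF h] power_add mult_ac flip: power_mult)
    have 2: "f (scale_pair u z) ^ (2 ^ s) = u ^ (2 ^ (k + s)) * u ^ (2 ^ s) * f z ^ (2 ^ s)"
      by (simp add: biform_scale_pair[OF f] power_add power_mult_distrib mult_ac flip: power_mult)
    have "N (scale_pair u z) = h (M (scale_pair u z)) - c * f (scale_pair u z) ^ (2 ^ s)"
      by (simp add: eq)
    also have "\<dots> = u ^ (2 ^ (k' + t)) * u ^ (2 ^ t) * (h (M z) - c * f z ^ (2 ^ s))"
      unfolding 1 2 exp by (simp add: algebra_simps)
    finally show ?thesis
      by (simp add: eq)
  qed
  define xs where "xs = [(N z, k' + t, t), (N z, t, k' + t)]"
  have "(\<Sum>(c, a, b)\<leftarrow>xs. c * u ^ (2 ^ a) * v ^ (2 ^ b)) = 0" for u v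
  proof -
    have "N (scale_pair (u + v) z) = N (scale_pair u z) + N (scale_pair v z)"
      by (simp add: scale_pair_def distrib_right flip: N)
    then show ?thesis
      unfolding Nu by (simp add: xs_def frobenius_add[OF card] algebra_simps)
  qed
  note coeff = bilinearized_polynomial_eq_0[OF card \<open>m > 0\<close> this]
  have "\<not> [k' + t = t] (mod m)"
  proof
    assume "[k' + t = t] (mod m)"
    then have "[k + s = s] (mod m)"
      using exps unfolding same_exponents_def by (meson cong_sym cong_trans)
    then show False
      using k by (metis add_0 cong_add_rcancel_nat)
  qed
  then show ?thesis
    using coeff[of "k' + t" t] by (simp add: xs_def)
qed

lemma same_exponents_imp_cong:
  assumes "same_exponents m k s k' t"
  shows "[k = k'] (mod m) \<or> [k + k' = 0] (mod m)"
proof -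
  have "int m dvd int k - int k'" if "int m dvd int (k + s) - int (k' + t)" "int m dvd int s - int t"
    using dvd_diff[OF that] by (simp add: algebra_simps)
  moreover have "int m dvd int (k + k') - int 0"
    if "int m dvd int (k + s) - int t" "int m dvd int s - int (k' + t)"
    using dvd_diff[OF that] by (simp add: algebra_simps)
  ultimately show ?thesis
    using assms unfolding same_exponents_def cong_nat_iff_dvd by blast
qed

text \<open>Only 0 and \<open>m/2\<close> double to 0 modulo \<open>m\<close>; the second hypothesis
  excludes \<open>m/2\<close> without a parity distinction.\<close>

lemma cong_double_eq_0:
  fixes k m :: nat
  assumes "[2 * k = 0] (mod m)" "2 * (k mod m) \<noteq> m"
  shows "[k = 0] (mod m)"
proof (cases "m = 0")
  case False
  have "m dvd 2 * (k mod m)"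
    using assms(1) by (simp add: cong_0_iff dvd_eq_mod_eq_0 mod_mult_right_eq)
  then obtain j where j: "2 * (k mod m) = m * j"
    by blast
  have "m * j < m * 2"
    using False by (simp flip: j)
  then have "j = 0 \<or> j = 1"
    by auto
  then show ?thesis
    using j assms(2) by (auto simp: cong_def)
qed (use assms in \<open>simp add: cong_def\<close>)

text \<open>Each congruence between \<open>k\<close> and \<open>k'\<close> selects one alternative
  of \<open>same_exponents\<close>. If the other one holds, then \<open>2 * k\<close> is zero modulo
  \<open>m\<close>, so \<open>k\<close> and \<open>k'\<close> are zero and the alternatives
  coincide.\<close>

lemma same_exponents_degree:
  assumes exps: "same_exponents m k s k' t" and k: "2 * (k mod m) \<noteq> m"
  shows "[k = k'] (mod m) \<Longrightarrow> [s = t] (mod m)"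
    and "[k + k' = 0] (mod m) \<Longrightarrow> [s = t + k'] (mod m)"
proof -
  have k0: "int m dvd int k" if "int m dvd 2 * int k"
    using cong_double_eq_0[OF _ k] that by (simp add: cong_nat_iff_dvd)
  show "[s = t] (mod m)" if "[k = k'] (mod m)"
  proof (rule disjE[OF exps[unfolded same_exponents_def]])
    assume *: "[k + s = t] (mod m) \<and> [s = k' + t] (mod m)"
    then have 1: "int m dvd int k + int s - int t" "int m dvd int s - int k' - int t"
        "int m dvd int k - int k'"
      using that by (simp_all add: cong_nat_iff_dvd algebra_simps)
    have "int m dvd (int k + int s - int t) - (int s - int k' - int t) + (int k - int k')"
      by (rule dvd_add[OF dvd_diff[OF 1(1,2)] 1(3)])
    then have "int m dvd int k"
      by (intro k0) (simp add: algebra_simps)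
    then have "int m dvd (int k + int s - int t) - int k"
      by (rule dvd_diff[OF 1(1)])
    then show ?thesis
      by (simp add: cong_nat_iff_dvd)
  qed simp
  show "[s = t + k'] (mod m)" if "[k + k' = 0] (mod m)"
  proof (rule disjE[OF exps[unfolded same_exponents_def]])
    assume *: "[k + s = k' + t] (mod m) \<and> [s = t] (mod m)"
    then have 1: "int m dvd int k + int s - int k' - int t" "int m dvd int s - int t"
        "int m dvd int k + int k'"
      using that by (simp_all add: cong_nat_iff_dvd algebra_simps)
    have "int m dvd (int k + int s - int k' - int t) - (int s - int t) + (int k + int k')"
      by (rule dvd_add[OF dvd_diff[OF 1(1,2)] 1(3)])
    then have "int m dvd int k"
      by (intro k0) (simp add: algebra_simps)
    then have "int m dvd (int s - int t) - ((int k + int k') - int k)"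
      by (rule dvd_diff[OF 1(2) dvd_diff[OF 1(3)]])
    then show ?thesis
      by (simp add: cong_nat_iff_dvd algebra_simps)
  qed (simp add: add.commute)
qed

lemma monomial_of_degree_cong:
  fixes T :: "'a::{field,finite} \<Rightarrow> 'a"
  assumes "CARD('a) = 2 ^ m" "[s = t] (mod m)" "monomial_of_degree s T"
  shows "monomial_of_degree t T"
proof -
  have "x ^ (2 ^ s) = x ^ (2 ^ t)" for x :: 'a
    using frobenius_mod[OF assms(1)] assms(2) by (metis cong_def)
  then show ?thesis
    using assms(3) unfolding monomial_of_degree_def by auto
qed

subsection \<open>The multiplicative group and its Sylow subgroup\<close>

lemma power_gcd_eq_1:
  fixes x :: "'a::field"
  assumes "x ^ a = 1" "x ^ b = 1"
  shows "x ^ gcd a b = 1"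
proof (cases "a = 0")
  case False
  then obtain i j where "a * i = b * j + gcd a b"
    using bezout_nat[of a b] by blast
  then have "x ^ (a * i) = x ^ (b * j) * x ^ gcd a b"
    by (simp add: power_add)
  then show ?thesis
    using assms by (simp add: power_mult)
qed (use assms in simp)

lemma group_mult_group: "group (mult_group :: 'a::field monoid)"
proof (rule groupI)
  fix x :: 'a
  assume "x \<in> carrier mult_group"
  then show "\<exists>y\<in>carrier mult_group. y \<otimes>\<^bsub>mult_group\<^esub> x = \<one>\<^bsub>mult_group\<^esub>"
    by (intro bexI[of _ "inverse x"]) (auto simp: mult_group_def)
qed (auto simp: mult_group_def)

lemma order_mult_group: "Coset.order (mult_group :: 'a::{field,finite} monoid) = CARD('a) - 1"
  by (simp add: mult_group_def Coset.order_def card_Diff_singleton)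

lemma card_power_eq_1_le:
  fixes n :: nat
  assumes "n > 0"
  shows "card {x::'a::field. x ^ n = 1} \<le> n"
proof -
  let ?q = "Polynomial.monom 1 n - 1 :: 'a poly"
  have "Polynomial.coeff ?q n = 1"
    using assms by simp
  then have "?q \<noteq> 0"
    by (metis coeff_0 zero_neq_one)
  moreover have "degree ?q \<le> n"
    by (intro degree_diff_le) (auto simp: degree_monom_le)
  ultimately show ?thesis
    using card_poly_roots_bound[of ?q] by (auto simp: poly_monom)
qed

text \<open>If no element had order exactly \<open>p^e\<close>, all \<open>p^e\<close> elements of
  \<open>P\<close> would satisfy \<open>x^(p^(e-1)) = 1\<close>, too many roots for a field. So
  \<open>P\<close> is cyclic, and a single element can stand for the torus later.\<close>

lemma sylow_subgroup_mult_group: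
  fixes P :: "'a::{field,finite} set"
  assumes card: "CARD('a) = 2 ^ m" and ppd: "primitive_prime_divisor p m" and "m > 0"
    and P: "sylow_subgroup p mult_group P"
  obtains \<zeta> e n where "2 ^ m - 1 = p ^ e * n" "card P = p ^ e" "\<not> p dvd n" "\<zeta> \<in> P" "\<zeta> \<noteq> 1"
    "P = range (\<lambda>i. \<zeta> ^ i)" "\<And>x. x \<in> P \<Longrightarrow> x ^ (p ^ e) = 1"
proof -
  interpret G: group "mult_group :: 'a monoid"
    by (rule group_mult_group)
  have sub: "subgroup P mult_group"
    using P by (simp add: sylow_subgroup_def)
  define e where "e = multiplicity p (2 ^ m - 1 :: nat)"
  have cardP: "card P = p ^ e"
    using P card by (simp add: sylow_subgroup_def order_mult_group e_def)
  have p: "prime p" "p dvd 2 ^ m - 1"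
    using ppd by (simp_all add: primitive_prime_divisor_def)
  have nz: "(2 ^ m - 1 :: nat) \<noteq> 0"
    using one_less_power[of "2::nat" m] \<open>m > 0\<close> by linarith
  have "\<not> is_unit p"
    using p(1) by auto
  then obtain n where n: "2 ^ m - 1 = p ^ e * n" "\<not> p dvd n"
    using multiplicity_decompose'[OF nz, of p] by (metis e_def)
  have "e > 0"
    unfolding e_def using p nz by (simp add: prime_multiplicity_gt_zero_iff)
  have pow: "x ^ (p ^ e) = 1" if "x \<in> P" for x
  proof -
    have "group (mult_group\<lparr>carrier := P\<rparr>)"
      using sub by (rule subgroup.subgroup_is_group[OF _ group_mult_group])
    then have "x [^]\<^bsub>mult_group\<lparr>carrier := P\<rparr>\<^esub> card P = \<one>\<^bsub>mult_group\<lparr>carrier := P\<rparr>\<^esub>"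
      using group.pow_order_eq_1[of "mult_group\<lparr>carrier := P\<rparr>" x] that by (simp add: Coset.order_def)
    moreover have "x [^]\<^bsub>mult_group\<lparr>carrier := P\<rparr>\<^esub> i = x ^ i" for i :: nat
      by (induction i) (simp_all add: mult_group_def nat_pow_def mult.commute)
    ultimately show ?thesis
      by (simp add: cardP mult_group_def)
  qed
  have closed: "x ^ i \<in> P" if "x \<in> P" for x i
    using that subgroup.one_closed[OF sub] subgroup.m_closed[OF sub]
    by (induction i) (simp_all add: mult_group_def)
  have "\<exists>\<zeta>\<in>P. \<zeta> ^ (p ^ (e - 1)) \<noteq> 1"
  proof (rule ccontr)
    assume "\<not> ?thesis"
    then have "P \<subseteq> {x. x ^ (p ^ (e - 1)) = 1}"
      by auto
    then have "card P \<le> card {x::'a. x ^ (p ^ (e - 1)) = 1}"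
      by (intro card_mono) auto
    also have "\<dots> \<le> p ^ (e - 1)"
      using p by (intro card_power_eq_1_le) (simp add: prime_gt_0_nat)
    also have "\<dots> < p ^ e"
      using prime_gt_1_nat[OF p(1)] \<open>e > 0\<close> by (intro power_strict_increasing) simp_all
    finally show False
      using cardP by simp
  qed
  then obtain \<zeta> where \<zeta>: "\<zeta> \<in> P" "\<zeta> ^ (p ^ (e - 1)) \<noteq> 1"
    by blast
  have "\<zeta> \<noteq> 0"
    using subgroup.subset[OF sub] \<zeta>(1) by (auto simp: mult_group_def)
  have "inj_on (\<lambda>i. \<zeta> ^ i) {..<p ^ e}"
  proof (rule linorder_inj_onI)
    fix i j :: nat
    assume ij: "i < j" "j \<in> {..<p ^ e}"
    show "\<zeta> ^ i \<noteq> \<zeta> ^ j"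
    proof
      assume "\<zeta> ^ i = \<zeta> ^ j"
      moreover have "\<zeta> ^ i * \<zeta> ^ (j - i) = \<zeta> ^ j"
        unfolding power_add[symmetric] using ij by simp
      ultimately have "\<zeta> ^ i * \<zeta> ^ (j - i) = \<zeta> ^ i * 1"
        by simp
      then have "\<zeta> ^ (j - i) = 1"
        using \<open>\<zeta> \<noteq> 0\<close> by simp
      then have gcd: "\<zeta> ^ gcd (j - i) (p ^ e) = 1"
        using power_gcd_eq_1 pow[OF \<zeta>(1)] by blast
      \<comment> \<open>The gcd is a power of \<open>p\<close> below \<open>p ^ e\<close>, as it
        divides the positive number \<open>j - i\<close>; so it divides
        \<open>p ^ (e - 1)\<close>.\<close>
      obtain t where t: "t \<le> e" "gcd (j - i) (p ^ e) = p ^ t"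
        using divides_primepow_nat[OF p(1)] by (metis gcd_dvd2)
      have "t \<noteq> e"
        using ij t by (metis diff_is_0_eq dvd_imp_le gcd_dvd1 leD lessThan_iff less_imp_diff_less neq0_conv)
      then have "p ^ (e - 1) = p ^ t * p ^ (e - 1 - t)"
        using t by (simp flip: power_add)
      then have "\<zeta> ^ (p ^ (e - 1)) = 1"
        using gcd t by (simp add: power_mult)
      then show False
        using \<zeta> by simp
    qed
  qed auto
  then have "card ((\<lambda>i. \<zeta> ^ i) ` {..<p ^ e}) = card P"
    by (simp add: card_image cardP)
  then have "(\<lambda>i. \<zeta> ^ i) ` {..<p ^ e} = P"
    using closed[OF \<zeta>(1)] by (intro card_subset_eq) auto
  then have "P = range (\<lambda>i. \<zeta> ^ i)"
    using closed[OF \<zeta>(1)] by blast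
  moreover have "\<zeta> \<noteq> 1"
    using \<zeta>(2) by auto
  ultimately show ?thesis
    using that n cardP \<zeta>(1) pow by blast
qed

text \<open>By Fermat \<open>p\<close> divides \<open>2^(p-1) - 1\<close>, so primitivity gives
  \<open>m \<le> p - 1\<close>. It keeps the number of conjugates, at most one for each Frobenius
  power, below \<open>p\<close>.\<close>

lemma less_primitive_prime_divisor:
  assumes "primitive_prime_divisor p m" "m > 1"
  shows "m < p"
proof -
  have p: "prime p" "p dvd 2 ^ m - 1" "\<And>i. 1 \<le> i \<Longrightarrow> i < m \<Longrightarrow> \<not> p dvd 2 ^ i - 1"
    using assms by (auto simp: primitive_prime_divisor_def)
  have "odd (2 ^ m - 1 :: nat)"
    using assms by simp
  then have "\<not> p dvd 2"
    using p by (metis dvd_trans primes_dvd_imp_eq two_is_prime_nat)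
  then have "[2 ^ (p - 1) = 1] (mod p)"
    using p fermat_theorem by blast
  then have "p dvd 2 ^ (p - 1) - 1"
    by (simp add: cong_altdef_nat)
  moreover have "1 \<le> p - 1"
    using prime_gt_1_nat[OF p(1)] by simp
  ultimately have "\<not> p - 1 < m"
    using p(3) by blast
  then show ?thesis
    using prime_gt_1_nat[OF p(1)] by simp
qed

text \<open>From \<open>p dvd 2^k + 1\<close> follows \<open>p dvd 2^(2*k) - 1\<close>, so
  \<open>m\<close> divides \<open>2 * k\<close> and then \<open>k\<close>; thus \<open>2^k\<close>
  is 1 modulo \<open>p\<close> and \<open>p\<close> divides 2.\<close>

lemma primitive_prime_divisor_not_dvd:
  assumes ppd: "primitive_prime_divisor p m" and k: "2 * (k mod m) \<noteq> m" and "m > 1"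
  shows "\<not> p dvd 2 ^ k + 1"
proof
  assume *: "p dvd 2 ^ k + 1"
  have p: "prime p" "p dvd 2 ^ m - 1" "\<And>i. 1 \<le> i \<Longrightarrow> i < m \<Longrightarrow> \<not> p dvd 2 ^ i - 1"
    using assms by (auto simp: primitive_prime_divisor_def)
  have p2: "p > 2"
    using less_primitive_prime_divisor[OF ppd] \<open>m > 1\<close> by simp
  have "[2 ^ m = 1] (mod p)"
    using p(2) by (simp add: cong_altdef_nat)
  then have pow: "[(2 ^ m) ^ j * 2 ^ i = 1 ^ j * 2 ^ i] (mod p)" for i j
    by (intro cong_mult cong_pow) simp_all
  have red: "[2 ^ i = 2 ^ (i mod m)] (mod p)" for i
  proof -
    have "(2::nat) ^ i = (2 ^ m) ^ (i div m) * 2 ^ (i mod m)"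
      by (simp flip: power_add power_mult)
    then show ?thesis
      using pow[of "i div m" "i mod m"] by simp
  qed
  have "(2 ^ k + 1) * (2 ^ k - 1) = (2 ^ (2 * k) - 1 :: nat)"
    by (simp add: algebra_simps power_mult power2_eq_square power_mult_distrib)
  then have "p dvd 2 ^ (2 * k) - 1"
    using * by (metis dvd_mult2)
  then have "[2 ^ (2 * k) = 1] (mod p)"
    by (simp add: cong_altdef_nat)
  then have "[2 ^ ((2 * k) mod m) = 1] (mod p)"
    using red by (meson cong_sym cong_trans)
  then have "p dvd 2 ^ ((2 * k) mod m) - 1"
    by (simp add: cong_altdef_nat)
  then have "(2 * k) mod m = 0"
    using p(3)[of "(2 * k) mod m"] \<open>m > 1\<close> by fastforce
  then have "[2 * k = 0] (mod m)"
    unfolding cong_def by (simp only: mod_0)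
  then have "[k = 0] (mod m)"
    using cong_double_eq_0 k by blast
  then have "[2 ^ k = 1] (mod p)"
    using red[of k] by (simp add: cong_def)
  then have "[2 ^ k + 1 = 1 + 1] (mod p)"
    by (rule cong_add) simp
  then have "p dvd 2"
    using * by (simp add: cong_dvd_iff numeral_2_eq_2)
  then show False
    using p2 by (simp add: dvd_imp_le leD)
qed

subsection \<open>The torus\<close>

lemma biprojective_scale:
  assumes "biprojective q r F"
  shows "F (scale_pair a z) = (a ^ (q + 1) * fst (F z), a ^ (r + 1) * snd (F z))"
  using biform_scale_pair[OF biprojective_imp_biform(1)[OF assms]]
    biform_scale_pair[OF biprojective_imp_biform(2)[OF assms]]
  by (simp add: prod_eq_iff)

lemma Z_map_apply:
  "Z_map q r a (z, w) = (scale_pair a z, (a ^ (q + 1) * fst w, a ^ (r + 1) * snd w))"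
  by (cases z; cases w) (simp add: Z_map_def scale_pair_def)

lemma Z_map_comp: "Z_map q r a \<circ> Z_map q r b = Z_map q r (a * b)"
  by (auto simp: Z_map_def fun_eq_iff power_mult_distrib mult_ac)

lemma Z_map_one: "Z_map q r 1 = id"
  by (auto simp: Z_map_def fun_eq_iff)

lemma Z_map_funpow: "Z_map q r a ^^ n = Z_map q r (a ^ n)"
  by (induction n) (simp_all add: Z_map_one Z_map_comp)

lemma Z_map_eq_iff: "Z_map q r a = Z_map q r b \<longleftrightarrow> a = b"
proof
  assume "Z_map q r a = Z_map q r b"
  then have "Z_map q r a ((1, 0), (0, 0)) = Z_map q r b ((1, 0), (0, 0))"
    by simp
  then show "a = b"
    by (simp add: Z_map_def)
qed simp

lemma pair_add_self_eq_0:
  assumes "CARD('a::{field,finite}) = 2 ^ m"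
  shows "(v :: 'a \<times> 'a) + v = 0"
  by (cases v) (simp add: add_self_eq_0[OF assms] zero_prod_def)

lemma Z_map_in_ELM:
  fixes a :: "'a::{field,finite}"
  assumes card: "CARD('a) = 2 ^ m" and "a \<noteq> 0"
  shows "Z_map q r a \<in> ELM"
proof -
  have "Z_map q r a \<circ> Z_map q r (inverse a) = id" "Z_map q r (inverse a) \<circ> Z_map q r a = id"
    using \<open>a \<noteq> 0\<close> by (simp_all add: Z_map_comp Z_map_one)
  then have "bij (Z_map q r a)"
    using o_bij by blast
  then show ?thesis
    by (auto simp: ELM_iff[OF pair_add_self_eq_0[OF card]] Z_map_def algebra_simps zero_prod_def)
qed

lemma Z_map_in_Aut_EL:
  fixes a :: "'a::{field,finite}"
  assumes card: "CARD('a) = 2 ^ m" and F: "biprojective q r F" and "a \<noteq> 0"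
  shows "Z_map q r a \<in> Aut_EL F"
  using Z_map_in_ELM[OF card \<open>a \<noteq> 0\<close>]
  by (simp add: Aut_EL_def image_graph_of_eq_iff[OF pair_add_self_eq_0[OF card]] Z_map_apply
      biprojective_scale[OF F])

section \<open>The centralizer of the torus and its order\<close>

lemma (in group) subgroup_centralizer:
  assumes "S \<subseteq> carrier G"
  shows "subgroup (centralizer G S) G"
proof (rule subgroup.intro)
  show "x \<otimes> y \<in> centralizer G S" if "x \<in> centralizer G S" "y \<in> centralizer G S" for x y
    using that assms unfolding centralizer_def by (auto simp: subset_iff) (metis m_assoc)
  show "inv x \<in> centralizer G S" if "x \<in> centralizer G S" for x
  proof -
    have "inv x \<otimes> s = s \<otimes> inv x" if s: "s \<in> S" for s
    proof -
      have "s \<in> carrier G" "x \<in> carrier G" "x \<otimes> s = s \<otimes> x"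
        using s assms \<open>x \<in> centralizer G S\<close> by (auto simp: centralizer_def)
      then show ?thesis
        by (metis inv_closed inv_solve_left inv_solve_right m_assoc m_closed)
    qed
    then show ?thesis
      using that by (simp add: centralizer_def)
  qed
qed (use assms in \<open>auto simp: centralizer_def subset_iff\<close>)

lemma C_group_eq:
  "C_group q r P F = {g \<in> Aut_EL F. \<forall>a\<in>P. g \<circ> Z_map q r a = Z_map q r a \<circ> g}"
  by (simp add: C_group_def centralizer_def ELM_group_def)

lemma group_Aut_EL:
  fixes F :: "'a::{field,finite} \<times> 'a \<Rightarrow> 'a \<times> 'a"
  assumes "CARD('a) = 2 ^ m"
  shows "group (ELM_group\<lparr>carrier := Aut_EL F\<rparr>)"
  using subgroup.subgroup_is_group[OF subgroup_Aut_EL group_ELM_group] pair_add_self_eq_0[OF assms]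
  by blast

lemma group_C_group:
  fixes F :: "'a::{field,finite} \<times> 'a \<Rightarrow> 'a \<times> 'a"
  assumes card: "CARD('a) = 2 ^ m" and F: "biprojective q r F" and "0 \<notin> P"
  shows "group (ELM_group\<lparr>carrier := C_group q r P F\<rparr>)"
proof -
  interpret A: group "ELM_group\<lparr>carrier := Aut_EL F\<rparr>"
    by (rule group_Aut_EL[OF card])
  have "subgroup (C_group q r P F) (ELM_group\<lparr>carrier := Aut_EL F\<rparr>)"
    unfolding C_group_def using \<open>0 \<notin> P\<close>
    by (intro A.subgroup_centralizer) (auto intro!: Z_map_in_Aut_EL[OF card F])
  then show ?thesis
    using subgroup.subgroup_is_group[OF _ A.is_group] by fastforce
qed

lemma Z_map_in_C_group:
  fixes F :: "'a::{field,finite} \<times> 'a \<Rightarrow> 'a \<times> 'a"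
  assumes "CARD('a) = 2 ^ m" "biprojective q r F" "a \<noteq> 0"
  shows "Z_map q r a \<in> C_group q r P F"
  using Z_map_in_Aut_EL[OF assms] by (simp add: C_group_eq Z_map_comp mult.commute)

text \<open>Lagrange for the torus, which has \<open>2^m - 1\<close> elements. It converts the index
  hypothesis into the \<open>p\<close>-part of the order of the centralizer.\<close>

lemma card_C_group:
  fixes F :: "'a::{field,finite} \<times> 'a \<Rightarrow> 'a \<times> 'a"
  assumes card: "CARD('a) = 2 ^ m" and F: "biprojective q r F" and "0 \<notin> P"
  shows "card (C_group q r P F) =
    subgroup_index ELM_group (C_group q r P F) (Z_group q r) * (2 ^ m - 1)"
proof -
  let ?C = "ELM_group\<lparr>carrier := C_group q r P F\<rparr>"
  interpret C: group ?C
    by (rule group_C_group[OF assms])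
  have "Z_map q r \<in> hom mult_group ?C"
    using Z_map_in_C_group[OF card F]
    by (auto intro!: homI simp: mult_group_def ELM_group_def Z_map_comp)
  then interpret Z: group_hom mult_group ?C "Z_map q r"
    by (simp add: group_hom_def group_hom_axioms_def group_mult_group C.is_group)
  have "subgroup (Z_group q r) ?C"
    using Z.img_is_subgroup by (simp add: Z_group_def mult_group_def)
  moreover have "card (Z_group q r :: (('a \<times> 'a) \<times> ('a \<times> 'a) \<Rightarrow> _) set) = 2 ^ m - 1"
    unfolding Z_group_def
    by (subst card_image) (auto intro!: inj_onI simp: Z_map_eq_iff card card_Diff_singleton)
  ultimately show ?thesis
    using C.lagrange[of "Z_group q r"] by (simp add: subgroup_index_def Coset.order_def)
qed

text \<open>
  If one of the components of \<open>F\<close> is additive, then \<open>F\<close> has a second torus of automorphisms; the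
  exponents \<open>\<alpha>\<close> and \<open>\<beta>\<close> single out that component.
\<close>

lemma dvd_subgroup_index:
  fixes F :: "'a::{field,finite} \<times> 'a \<Rightarrow> 'a \<times> 'a" and \<alpha> \<beta> :: "'a \<Rightarrow> 'a"
  assumes card: "CARD('a) = 2 ^ m" and "m > 0" and F: "biprojective q r F" and "0 \<notin> P"
    and \<alpha>: "\<alpha> 1 = 1" "\<And>a b. \<alpha> (a * b) = \<alpha> a * \<alpha> b"
    and \<beta>: "\<beta> 1 = 1" "\<And>a b. \<beta> (a * b) = \<beta> a * \<beta> b"
    and inj: "\<And>a b. \<alpha> a = \<alpha> b \<Longrightarrow> \<beta> a = \<beta> b \<Longrightarrow> a = b"
    and add: "\<And>a z w. (1 - \<alpha> a) * polar (\<lambda>z. fst (F z)) z w = 0"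
      "\<And>a z w. (1 - \<beta> a) * polar (\<lambda>z. snd (F z)) z w = 0"
  shows "2 ^ m - 1 dvd subgroup_index ELM_group (C_group q r P F) (Z_group q r)"
proof -
  let ?C = "ELM_group\<lparr>carrier := C_group q r P F\<rparr>"
  interpret C: group ?C
    by (rule group_C_group[OF card F \<open>0 \<notin> P\<close>])
  \<comment> \<open>Scales the deviation from the graph: \<open>u\<close> goes to
    \<open>f + \<alpha> c * (u - f)\<close> with \<open>f = fst (F z)\<close>, and \<open>v\<close>
    likewise. So the graph is fixed pointwise, and the map is additive as soon as
    \<open>(1 - \<alpha> c) * f\<close> and its analogue are.\<close>
  define E :: "'a \<Rightarrow> ('a \<times> 'a) \<times> ('a \<times> 'a) \<Rightarrow> ('a \<times> 'a) \<times> ('a \<times> 'a)" where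
    "E c = (\<lambda>(z, u, v).
       (z, \<alpha> c * u + (1 - \<alpha> c) * fst (F z), \<beta> c * v + (1 - \<beta> c) * snd (F z)))" for c
  note char2 = pair_add_self_eq_0[OF card]
  have E_comp: "E c \<circ> E d = E (c * d)" for c d
    by (auto simp: E_def \<alpha> \<beta> fun_eq_iff algebra_simps)
  have E_one: "E 1 = id"
    by (auto simp: E_def \<alpha> \<beta> fun_eq_iff)
  have E_Z: "E c \<circ> Z_map q r a = Z_map q r a \<circ> E c" for c a
  proof
    fix x :: "('a \<times> 'a) \<times> ('a \<times> 'a)"
    obtain z u v where x: "x = (z, u, v)"
      by (cases x)
    show "(E c \<circ> Z_map q r a) x = (Z_map q r a \<circ> E c) x"
      by (simp add: x E_def Z_map_apply biprojective_scale[OF F] algebra_simps)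
  qed
  have E_C: "E c \<in> C_group q r P F" if "c \<noteq> 0" for c
  proof -
    have "E c \<circ> E (inverse c) = id" "E (inverse c) \<circ> E c = id"
      using that by (simp_all add: E_comp E_one)
    then have "bij (E c)"
      using o_bij by blast
    moreover have "E c (x + y) = E c x + E c y" for x y
    proof -
      obtain z u v where x: "x = (z, u, v)"
        by (cases x)
      obtain z' u' v' where y: "y = (z', u', v')"
        by (cases y)
      have "(1 - \<alpha> c) * fst (F (z + z')) = (1 - \<alpha> c) * fst (F z) + (1 - \<alpha> c) * fst (F z')"
        "(1 - \<beta> c) * snd (F (z + z')) = (1 - \<beta> c) * snd (F z) + (1 - \<beta> c) * snd (F z')"
        using add(1)[of c z z'] add(2)[of c z z'] unfolding polar_def right_diff_distrib
        by (simp_all add: diff_eq_eq add.commute)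
      then show ?thesis
        by (simp add: E_def x y algebra_simps)
    qed
    ultimately have "E c \<in> ELM"
      by (auto simp: ELM_iff[OF char2] E_def)
    moreover have "E c (z, F z) = (z, F z)" for z
      by (cases "F z") (simp add: E_def algebra_simps)
    ultimately have "E c \<in> ELM" "E c ` graph_of F = graph_of F"
      by (simp_all add: image_graph_of_eq_iff[OF char2])
    then show ?thesis
      using E_Z by (simp add: C_group_eq Aut_EL_def)
  qed
  define H where "H = (\<lambda>(a, c). Z_map q r a \<circ> E c)"
  let ?D = "(mult_group :: 'a monoid) \<times>\<times> (mult_group :: 'a monoid)"
  have "H \<in> hom ?D ?C"
  proof (rule homI)
    show "H x \<in> carrier ?C" if xD: "x \<in> carrier ?D" for x
    proof -
      obtain a c where x: "x = (a, c)" "a \<noteq> 0" "c \<noteq> 0"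
        using xD by (cases x) (simp add: mult_group_def)
      then show ?thesis
        using C.m_closed[of "Z_map q r a" "E c"] E_C[OF x(3)] Z_map_in_C_group[OF card F x(2)]
        by (simp add: H_def ELM_group_def)
    qed
    show "H (x \<otimes>\<^bsub>?D\<^esub> y) = H x \<otimes>\<^bsub>?C\<^esub> H y" for x y
    proof -
      have "Z_map q r (a * b) \<circ> E (c * d) = (Z_map q r a \<circ> E c) \<circ> (Z_map q r b \<circ> E d)" for a b c d
        unfolding E_comp[symmetric] Z_map_comp[symmetric] using E_Z by (metis comp_assoc)
      then show ?thesis
        by (cases x; cases y) (simp add: H_def mult_group_def ELM_group_def)
    qed
  qed
  then interpret H: group_hom ?D ?C H
    by (simp add: group_hom_def group_hom_axioms_def group_mult_group C.is_group DirProd_group)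
  have "inj_on H (carrier ?D)"
  proof (rule inj_onI)
    fix x y
    assume "x \<in> carrier ?D" "y \<in> carrier ?D" and eq: "H x = H y"
    obtain a c b d where xy: "x = (a, c)" "y = (b, d)"
      by (cases x; cases y)
    have a0: "a \<noteq> 0"
      using \<open>x \<in> carrier ?D\<close> by (simp add: xy mult_group_def)
    have F0: "F 0 = 0"
      using biprojective_scale[OF F, of 0 0] by (simp add: scale_pair_def zero_prod_def)
    \<comment> \<open>On the graph \<open>E\<close> acts trivially, which exposes the parameter of
      \<open>Z_map\<close>; at \<open>(0, (1, 1))\<close>, where \<open>F\<close> contributes 0, the
      values of \<open>\<alpha>\<close> and \<open>\<beta>\<close> remain.\<close>
    have "H x ((1, 0), F (1, 0)) = H y ((1, 0), F (1, 0))"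
      by (simp add: eq)
    then have ab: "a = b"
      by (cases "F (1, 0)") (simp add: H_def xy E_def Z_map_apply scale_pair_def)
    have "H x (0, (1, 1)) = H y (0, (1, 1))"
      by (simp add: eq)
    then have "\<alpha> c = \<alpha> d" "\<beta> c = \<beta> d"
      using a0 by (simp_all add: H_def xy E_def Z_map_apply F0 ab)
    then show "x = y"
      using inj by (simp add: xy ab)
  qed
  then have "card (H ` carrier ?D) = (2 ^ m - 1) * (2 ^ m - 1)"
    by (simp add: card_image mult_group_def card_cartesian_product card card_Diff_singleton)
  moreover have "subgroup (H ` carrier ?D) ?C"
    by (rule H.img_is_subgroup)
  then have "card (rcosets\<^bsub>?C\<^esub> (H ` carrier ?D)) * card (H ` carrier ?D) = card (C_group q r P F)"
    using C.lagrange by (simp add: Coset.order_def)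
  \<comment> \<open>The torus itself accounts for one factor of the order; the other must divide the
    index.\<close>
  ultimately have "(2 ^ m - 1) * (2 ^ m - 1) dvd card (C_group q r P F)"
    by (metis dvd_triv_right)
  moreover have "(2 ^ m - 1 :: nat) \<noteq> 0"
    using one_less_power[of "2::nat" m] \<open>m > 0\<close> by linarith
  ultimately show ?thesis
    by (simp add: card_C_group[OF card F \<open>0 \<notin> P\<close>])
qed

subsection \<open>Intertwiners of the tori\<close>

text \<open>The two Frobenius powers agree on a subring containing \<open>b\<close>, hence
  everywhere. This yields one common degree for all blocks of \<open>M\<close>.\<close>

lemma monomial_degree_unique:
  fixes b :: "'a::{field,finite}" and T :: "'a \<Rightarrow> 'a"
  assumes card: "CARD('a) = 2 ^ m" and ppd: "primitive_prime_divisor p m"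
    and b: "b \<noteq> 1" "b ^ (p ^ e) = 1" "b ^ (2 ^ s) = b ^ (2 ^ t)"
    and T: "monomial_of_degree s T"
  shows "monomial_of_degree t T"
proof -
  have "p ^ e > 0"
    using ppd by (simp add: primitive_prime_divisor_def prime_gt_0_nat)
  then have "{x::'a. x ^ (2 ^ s) = x ^ (2 ^ t)} = UNIV"
    using b
    by (intro subring_eq_UNIV[OF card ppd, where b = b and e = e])
       (auto simp: power_mult_distrib frobenius_add[OF card] power_0_left)
  then have "x ^ (2 ^ s) = x ^ (2 ^ t)" for x :: 'a
    by blast
  then show ?thesis
    using T by (simp add: monomial_of_degree_def)
qed

text \<open>Blocks of \<open>M\<close> intertwine \<open>b\<close> with \<open>c\<close>, blocks of
  \<open>L\<close> intertwine \<open>b^(q+1)\<close> or \<open>b^(r+1)\<close> with a power of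
  \<open>c\<close>. It serves twice: for automorphisms, where \<open>c = b^(2^t)\<close> bounds the
  number of conjugates, and for the adjusted equivalence, where the shape of the blocks
  matters.\<close>

lemma intertwiner_blocks:
  fixes \<gamma> :: "('a::{field,finite} \<times> 'a) \<times> ('a \<times> 'a) \<Rightarrow> ('a \<times> 'a) \<times> ('a \<times> 'a)"
  assumes card: "CARD('a) = 2 ^ m" and ppd: "primitive_prime_divisor p m"
    and b: "b \<noteq> 1" "b ^ (p ^ e) = 1"
    and q: "\<not> p dvd q + 1" "\<not> p dvd r + 1"
    and \<gamma>: "\<gamma> \<in> ELM" "\<gamma> \<circ> Z_map q r b = Z_map q' r' c \<circ> \<gamma>"
  obtains t M\<^sub>1 M\<^sub>2 M\<^sub>3 M\<^sub>4 N L\<^sub>1 L\<^sub>2 L\<^sub>3 L\<^sub>4 where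
    "t < m" "c = b ^ (2 ^ t)"
    "\<gamma> = block (block M\<^sub>1 M\<^sub>2 M\<^sub>3 M\<^sub>4) (\<lambda>_. 0) N (block L\<^sub>1 L\<^sub>2 L\<^sub>3 L\<^sub>4)"
    "block M\<^sub>1 M\<^sub>2 M\<^sub>3 M\<^sub>4 \<in> GL" "F2_linear N" "block L\<^sub>1 L\<^sub>2 L\<^sub>3 L\<^sub>4 \<in> GL"
    "\<forall>h \<in> {M\<^sub>1, M\<^sub>2, M\<^sub>3, M\<^sub>4}. h = (\<lambda>_. 0) \<or> monomial_of_degree t h"
    "\<forall>h \<in> {L\<^sub>1, L\<^sub>2, L\<^sub>3, L\<^sub>4}. h = (\<lambda>_. 0) \<or> (\<exists>s. monomial_of_degree s h)"
proof -
  note char2 = pair_add_self_eq_0[OF card]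
  note lin = F2_linear_iff_additive[OF char2 char2]
  have add: "\<gamma> (x + y) = \<gamma> x + \<gamma> y" and bij: "bij \<gamma>" and zero: "fst (\<gamma> (0, w)) = 0" for x y w
    using \<gamma>(1) unfolding ELM_iff[OF char2] by blast+
  define M where "M = (\<lambda>z. fst (\<gamma> (z, 0)))"
  define N where "N = (\<lambda>z. snd (\<gamma> (z, 0)))"
  define L where "L = (\<lambda>w. snd (\<gamma> (0, w)))"
  have M_add: "M (x + y) = M x + M y" and N_add: "N (x + y) = N x + N y"
    and L_add: "L (x + y) = L x + L y" for x y
    using add[of "(x, 0)" "(y, 0)"] add[of "(0, x)" "(0, y)"] by (simp_all add: M_def N_def L_def)
  have \<gamma>_eq: "\<gamma> (z, w) = (M z, N z + L w)" for z w
    using add[of "(z, 0)" "(0, w)"] zero[of w] by (simp add: M_def N_def L_def prod_eq_iff)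
  have "surj M"
  proof (rule surjI[of _ "\<lambda>z. fst (inv_into UNIV \<gamma> (z, 0))"])
    fix z
    obtain z' w' where "inv_into UNIV \<gamma> (z, 0) = (z', w')"
      by (cases "inv_into UNIV \<gamma> (z, 0)")
    then show "M (fst (inv_into UNIV \<gamma> (z, 0))) = z"
      using bij_inv_eq_iff[OF bij] \<gamma>_eq[of z' w'] by (metis fst_conv)
  qed
  then have M_bij: "bij M"
    by (simp add: bij_def finite_UNIV_surj_inj)
  have "inj L"
  proof (rule injI)
    fix x y
    assume "L x = L y"
    then have "\<gamma> (0, x) = \<gamma> (0, y)"
      by (simp add: \<gamma>_eq)
    then show "x = y"
      using bij by (simp add: bij_def inj_eq)
  qed
  then have L_bij: "bij L"
    by (simp add: bij_def finite_UNIV_inj_surj)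
  have comm: "\<gamma> (Z_map q r b x) = Z_map q' r' c (\<gamma> x)" for x
    using \<gamma>(2) by (metis comp_apply)
  have M_semi: "M (b * x, b * y) = (c * fst (M (x, y)), c * snd (M (x, y)))" for x y
    using comm[of "((x, y), 0)"] by (simp add: Z_map_apply scale_pair_def \<gamma>_eq)
  have M0: "M 0 = 0" and L0: "L 0 = 0"
    using additive_diff(1)[of M] additive_diff(1)[of L] M_add L_add by blast+
  have N0: "N 0 = 0"
    using additive_diff(1)[of N] N_add by blast
  have L_semi: "L (b ^ (q + 1) * u, b ^ (r + 1) * v) =
      (c ^ (q' + 1) * fst (L (u, v)), c ^ (r' + 1) * snd (L (u, v)))" for u v
    using comm[of "(0, (u, v))"]
    by (simp add: Z_map_apply \<gamma>_eq M0 N0) (simp add: scale_pair_def zero_prod_def[symmetric] N0)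
  define M\<^sub>1 where "M\<^sub>1 = (\<lambda>x. fst (M (x, 0)))"
  define M\<^sub>2 where "M\<^sub>2 = (\<lambda>y. fst (M (0, y)))"
  define M\<^sub>3 where "M\<^sub>3 = (\<lambda>x. snd (M (x, 0)))"
  define M\<^sub>4 where "M\<^sub>4 = (\<lambda>y. snd (M (0, y)))"
  define L\<^sub>1 where "L\<^sub>1 = (\<lambda>x. fst (L (x, 0)))"
  define L\<^sub>2 where "L\<^sub>2 = (\<lambda>y. fst (L (0, y)))"
  define L\<^sub>3 where "L\<^sub>3 = (\<lambda>x. snd (L (x, 0)))"
  define L\<^sub>4 where "L\<^sub>4 = (\<lambda>y. snd (L (0, y)))"
  have M_block: "M = block M\<^sub>1 M\<^sub>2 M\<^sub>3 M\<^sub>4"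
  proof -
    have "M (x, y) = block M\<^sub>1 M\<^sub>2 M\<^sub>3 M\<^sub>4 (x, y)" for x y
      using M_add[of "(x, 0)" "(0, y)"] by (simp add: block_def M\<^sub>1_def M\<^sub>2_def M\<^sub>3_def M\<^sub>4_def prod_eq_iff)
    then show ?thesis
      by (simp add: fun_eq_iff)
  qed
  have L_block: "L = block L\<^sub>1 L\<^sub>2 L\<^sub>3 L\<^sub>4"
  proof -
    have "L (x, y) = block L\<^sub>1 L\<^sub>2 L\<^sub>3 L\<^sub>4 (x, y)" for x y
      using L_add[of "(x, 0)" "(0, y)"] by (simp add: block_def L\<^sub>1_def L\<^sub>2_def L\<^sub>3_def L\<^sub>4_def prod_eq_iff)
    then show ?thesis
      by (simp add: fun_eq_iff)
  qed
  \<comment> \<open>The order of \<open>b\<close> is a power of \<open>p\<close>, so an exponent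
    prime to \<open>p\<close> cannot kill \<open>b\<close>.\<close>
  have coprime: "b ^ n \<noteq> 1" if "\<not> p dvd n" for n
  proof
    assume "b ^ n = 1"
    moreover have "coprime n (p ^ e)"
      using that ppd
      by (metis coprime_commute coprime_power_right_iff prime_imp_coprime primitive_prime_divisor_def)
    ultimately show False
      using power_gcd_eq_1[of b n "p ^ e"] b by simp
  qed
  have bM: "h = (\<lambda>_. 0) \<or> (\<exists>s<m. monomial_of_degree s h \<and> c = b ^ (2 ^ s))"
    if "h \<in> {M\<^sub>1, M\<^sub>2, M\<^sub>3, M\<^sub>4}" for h
  proof -
    have "h (x + y) = h x + h y" for x y
      using that M_add[of "(x, 0)" "(y, 0)"] M_add[of "(0, x)" "(0, y)"]
      by (auto simp: M\<^sub>1_def M\<^sub>2_def M\<^sub>3_def M\<^sub>4_def)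
    moreover have "h (b * x) = c * h x" for x
      using that M_semi[of x 0] M_semi[of 0 x]
      by (auto simp: M\<^sub>1_def M\<^sub>2_def M\<^sub>3_def M\<^sub>4_def)
    ultimately show ?thesis
      using semilinear_imp_monomial[OF card ppd b, of h c] by blast
  qed
  have bL: "h = (\<lambda>_. 0) \<or> (\<exists>s. monomial_of_degree s h)"
    if h: "h \<in> {L\<^sub>1, L\<^sub>2, L\<^sub>3, L\<^sub>4}" for h
  proof -
    have h_add: "h (x + y) = h x + h y" for x y
      using h L_add[of "(x, 0)" "(y, 0)"] L_add[of "(0, x)" "(0, y)"]
      by (auto simp: L\<^sub>1_def L\<^sub>2_def L\<^sub>3_def L\<^sub>4_def)
    obtain n z where n: "n = q + 1 \<or> n = r + 1" and semi: "\<And>x. h (b ^ n * x) = z * h x"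
    proof -
      consider "h = L\<^sub>1" | "h = L\<^sub>2" | "h = L\<^sub>3" | "h = L\<^sub>4"
        using h by blast
      then show thesis
        using L_semi[of _ 0] L_semi[of 0]
          that[of "q + 1" "c ^ (q' + 1)"] that[of "r + 1" "c ^ (q' + 1)"]
          that[of "q + 1" "c ^ (r' + 1)"] that[of "r + 1" "c ^ (r' + 1)"]
        by cases (simp_all add: L\<^sub>1_def L\<^sub>2_def L\<^sub>3_def L\<^sub>4_def)
    qed
    have "b ^ n \<noteq> 1"
      using coprime n q by blast
    moreover have "(b ^ n) ^ (p ^ e) = 1"
      using b(2) by (metis power_commutes power_mult mult.commute power_one)
    ultimately show ?thesis
      using semilinear_imp_monomial[OF card ppd _ _ h_add semi] by blast
  qed
  \<comment> \<open>One nonzero block expresses \<open>c\<close> as a Frobenius power of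
    \<open>b\<close>; this exponent then serves for all blocks of \<open>M\<close>.\<close>
  have "M\<^sub>1 \<noteq> (\<lambda>_. 0) \<or> M\<^sub>2 \<noteq> (\<lambda>_. 0) \<or> M\<^sub>3 \<noteq> (\<lambda>_. 0) \<or> M\<^sub>4 \<noteq> (\<lambda>_. 0)"
  proof (rule ccontr)
    assume "\<not> ?thesis"
    then have "M (1, 0) = M (0, 0)"
      unfolding M_block by (simp add: block_def)
    then show False
      using M_bij by (simp add: bij_def inj_eq)
  qed
  then obtain t where t: "t < m" "c = b ^ (2 ^ t)"
    using bM by blast
  have "h = (\<lambda>_. 0) \<or> monomial_of_degree t h" if "h \<in> {M\<^sub>1, M\<^sub>2, M\<^sub>3, M\<^sub>4}" for h
    using bM[OF that] monomial_degree_unique[OF card ppd b] t(2) by metis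
  moreover have "\<gamma> = block M (\<lambda>_. 0) N L"
    by (auto simp: fun_eq_iff block_def \<gamma>_eq)
  moreover have "M \<in> GL" "F2_linear N" "L \<in> GL"
    using M_bij L_bij M_add N_add L_add unfolding GL_def lin mem_Collect_eq by blast+
  ultimately show ?thesis
    using that[of t M\<^sub>1 M\<^sub>2 M\<^sub>3 M\<^sub>4 N L\<^sub>1 L\<^sub>2 L\<^sub>3 L\<^sub>4] t bL by (simp flip: M_block L_block)
qed

section \<open>Adjusting an equivalence so that it intertwines the tori\<close>

lemma funpow_conjugate:
  assumes "g \<circ> h = id" "h \<circ> g = id"
  shows "(h \<circ> f \<circ> g) ^^ n = h \<circ> f ^^ n \<circ> g"
proof (induction n)
  case 0
  then show ?case
    using assms by simp
next
  case (Suc n)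
  have "(h \<circ> f \<circ> g) ^^ Suc n = h \<circ> f \<circ> (g \<circ> h) \<circ> f ^^ n \<circ> g"
    unfolding funpow.simps Suc by (simp only: comp_assoc)
  also have "\<dots> = h \<circ> f ^^ Suc n \<circ> g"
    unfolding assms(1) by (simp add: comp_assoc)
  finally show ?case .
qed

lemma EL_equivalent_imp_monomial:
  fixes F G :: "'a::{field,finite} \<times> 'a \<Rightarrow> 'a \<times> 'a"
  assumes card: "CARD('a) = 2 ^ m" and "m > 2" and ppd: "primitive_prime_divisor p m"
    and P: "sylow_subgroup p mult_group P"
    and F: "biprojective q r F" and G: "biprojective q' r' G"
    and q: "\<not> p dvd q + 1" "\<not> p dvd r + 1"
    and index: "\<not> p dvd subgroup_index ELM_group (C_group q r P F) (Z_group q r)"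
    and "EL_equivalent F G"
  shows "\<exists>t M\<^sub>1 M\<^sub>2 M\<^sub>3 M\<^sub>4 N L\<^sub>1 L\<^sub>2 L\<^sub>3 L\<^sub>4.
    monomial_EL_equivalence F G t M\<^sub>1 M\<^sub>2 M\<^sub>3 M\<^sub>4 N L\<^sub>1 L\<^sub>2 L\<^sub>3 L\<^sub>4"
proof -
  note char2 = pair_add_self_eq_0[OF card]
  have p: "prime p"
    using ppd by (simp add: primitive_prime_divisor_def)
  obtain \<zeta> e n where n: "2 ^ m - 1 = p ^ e * n" "\<not> p dvd n" and cardP: "card P = p ^ e"
    and \<zeta>: "\<zeta> \<in> P" "\<zeta> \<noteq> 1" and P_eq: "P = range (\<lambda>i. \<zeta> ^ i)"
    and pow: "\<And>x. x \<in> P \<Longrightarrow> x ^ (p ^ e) = 1"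
    using sylow_subgroup_mult_group[OF card ppd _ P] \<open>m > 2\<close> by (metis gr_zeroI not_less0)
  have P_sub: "subgroup P mult_group"
    using P by (simp add: sylow_subgroup_def)
  then have P0: "0 \<notin> P"
    using subgroup.subset by (fastforce simp: mult_group_def)
  let ?A = "ELM_group\<lparr>carrier := Aut_EL F\<rparr>"
  interpret A: group ?A
    by (rule group_Aut_EL[OF card])
  have pow_A: "g [^]\<^bsub>?A\<^esub> i = g ^^ i" for g and i :: nat
  proof (induction i)
    case (Suc i)
    have "g [^]\<^bsub>?A\<^esub> Suc i = g [^]\<^bsub>?A\<^esub> i \<circ> g"
      by (simp add: ELM_group_def)
    then show ?case
      by (simp only: Suc funpow_Suc_right)
  qed (simp add: ELM_group_def)
  have inv_A: "inv\<^bsub>?A\<^esub> g = inv_into UNIV g" "inv_into UNIV g \<in> Aut_EL F" if "g \<in> Aut_EL F" for g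
  proof -
    have E: "g \<in> ELM"
      using that by (simp add: Aut_EL_def)
    have "inv\<^bsub>?A\<^esub> g = inv\<^bsub>ELM_group\<^esub> g"
      using group.m_inv_consistent[OF group_ELM_group subgroup_Aut_EL] char2 that by blast
    then show "inv\<^bsub>?A\<^esub> g = inv_into UNIV g"
      using inv_ELM_group[OF char2 E] by simp
    then show "inv_into UNIV g \<in> Aut_EL F"
      using A.inv_closed[of g] that by simp
  qed
  let ?Z = "Z_map q r" and ?S = "Z_map q r ` P"
  have "?Z \<in> hom mult_group ?A"
    using Z_map_in_Aut_EL[OF card F]
    by (auto intro!: homI simp: mult_group_def ELM_group_def Z_map_comp)
  then interpret Z: group_hom mult_group ?A ?Z
    by (simp add: group_hom_def group_hom_axioms_def group_mult_group A.is_group)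
  have S: "subgroup ?S ?A" "card ?S = p ^ e"
    using Z.subgroup_img_is_subgroup[OF P_sub] cardP
    by (simp_all add: card_image inj_on_def Z_map_eq_iff)
  have centralizer: "{g \<in> carrier ?A. g \<otimes>\<^bsub>?A\<^esub> ?Z \<zeta> = ?Z \<zeta> \<otimes>\<^bsub>?A\<^esub> g} = C_group q r P F"
  proof -
    have "g \<circ> ?Z (\<zeta> ^ i) = ?Z (\<zeta> ^ i) \<circ> g" if g: "g \<circ> ?Z \<zeta> = ?Z \<zeta> \<circ> g" for g i
    proof (induction i)
      case (Suc i)
      have "g \<circ> ?Z (\<zeta> ^ Suc i) = (g \<circ> ?Z \<zeta>) \<circ> ?Z (\<zeta> ^ i)"
        by (simp add: comp_assoc Z_map_comp)
      also have "\<dots> = ?Z \<zeta> \<circ> (g \<circ> ?Z (\<zeta> ^ i))"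
        by (simp add: g comp_assoc)
      also have "\<dots> = (?Z \<zeta> \<circ> ?Z (\<zeta> ^ i)) \<circ> g"
        by (simp only: Suc.IH comp_assoc)
      finally show ?case
        by (simp only: Z_map_comp power_Suc)
    qed (simp add: Z_map_one)
    then have "g \<circ> ?Z \<zeta> = ?Z \<zeta> \<circ> g \<longleftrightarrow> (\<forall>a\<in>P. g \<circ> ?Z a = ?Z a \<circ> g)" for g
      using \<zeta>(1) unfolding P_eq by blast
    then show ?thesis
      by (simp add: C_group_eq ELM_group_def)
  qed
  have card_C: "card {g \<in> carrier ?A. g \<otimes>\<^bsub>?A\<^esub> ?Z \<zeta> = ?Z \<zeta> \<otimes>\<^bsub>?A\<^esub> g} =
      p ^ e * (n * subgroup_index ELM_group (C_group q r P F) (Z_group q r))"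
    unfolding centralizer using card_C_group[OF card F P0] n(1) by (simp add: mult_ac)
  have not_dvd: "\<not> p dvd n * subgroup_index ELM_group (C_group q r P F) (Z_group q r)"
    using n(2) index p by (simp add: prime_dvd_mult_iff)
  \<comment> \<open>A conjugate \<open>?Z a\<close> makes \<open>g\<close> an intertwiner of
    \<open>?Z \<zeta>\<close> and \<open>?Z a\<close>, so \<open>a\<close> is
    \<open>\<zeta>^(2^t)\<close> with \<open>t < m\<close>.\<close>
  have conjugates: "card {x \<in> ?S. \<exists>g\<in>carrier ?A. x = g \<otimes>\<^bsub>?A\<^esub> ?Z \<zeta> \<otimes>\<^bsub>?A\<^esub> inv\<^bsub>?A\<^esub> g} < p"
  proof -
    have "{x \<in> ?S. \<exists>g\<in>carrier ?A. x = g \<otimes>\<^bsub>?A\<^esub> ?Z \<zeta> \<otimes>\<^bsub>?A\<^esub> inv\<^bsub>?A\<^esub> g}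
      \<subseteq> (\<lambda>s. ?Z (\<zeta> ^ (2 ^ s))) ` {..<m}"
    proof
      fix x
      assume "x \<in> {x \<in> ?S. \<exists>g\<in>carrier ?A. x = g \<otimes>\<^bsub>?A\<^esub> ?Z \<zeta> \<otimes>\<^bsub>?A\<^esub> inv\<^bsub>?A\<^esub> g}"
      then obtain a g where x: "x = ?Z a" and "g \<in> carrier ?A"
        and "x = g \<otimes>\<^bsub>?A\<^esub> ?Z \<zeta> \<otimes>\<^bsub>?A\<^esub> inv\<^bsub>?A\<^esub> g"
        by blast
      moreover from this have g: "g \<in> Aut_EL F"
        by simp
      ultimately      have xg: "x = g \<circ> ?Z \<zeta> \<circ> inv_into UNIV g"
        unfolding inv_A(1)[OF g] by (simp add: ELM_group_def)
      have gE: "g \<in> ELM"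
        using g by (simp add: Aut_EL_def)
      then have "inj g"
        by (simp add: ELM_iff[OF char2] bij_def)
      then have "g \<circ> ?Z \<zeta> = ?Z a \<circ> g"
        using xg x by (metis comp_assoc comp_id inv_o_cancel)
      from intertwiner_blocks[OF card ppd \<zeta>(2) pow[OF \<zeta>(1)] q gE this]
      obtain t where "t < m" "a = \<zeta> ^ (2 ^ t)"
        by metis
      then show "x \<in> (\<lambda>s. ?Z (\<zeta> ^ (2 ^ s))) ` {..<m}"
        using x by blast
    qed
    then have "card {x \<in> ?S. \<exists>g\<in>carrier ?A. x = g \<otimes>\<^bsub>?A\<^esub> ?Z \<zeta> \<otimes>\<^bsub>?A\<^esub> inv\<^bsub>?A\<^esub> g}
      \<le> card ((\<lambda>s. ?Z (\<zeta> ^ (2 ^ s))) ` {..<m})"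
      by (rule card_mono[rotated]) simp
    also have "\<dots> \<le> m"
      using card_image_le[of "{..<m}"] by simp
    also have "m < p"
      using less_primitive_prime_divisor[OF ppd] \<open>m > 2\<close> by simp
    finally show ?thesis .
  qed
  obtain \<gamma> where \<gamma>: "\<gamma> \<in> ELM" "\<gamma> ` graph_of F = graph_of G"
    using \<open>EL_equivalent F G\<close> by (auto simp: EL_equivalent_def EL_equivalent_via_def)
  let ?\<gamma>' = "inv_into UNIV \<gamma>"
  have bij: "bij \<gamma>"
    using \<gamma>(1) by (simp add: ELM_iff[OF char2])
  then have inv: "\<gamma> \<circ> ?\<gamma>' = id" "?\<gamma>' \<circ> \<gamma> = id"
    using surj_iff inv_o_cancel by (auto simp: bij_def)
  \<comment> \<open>A generator of the torus of \<open>G\<close>, transported to an automorphism of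
    \<open>F\<close>; it has \<open>p\<close>-power order but need not lie in
    \<open>?S\<close>.\<close>
  define \<tau> where "\<tau> = ?\<gamma>' \<circ> Z_map q' r' \<zeta> \<circ> \<gamma>"
  have \<zeta>0: "\<zeta> \<noteq> 0"
    using \<zeta>(1) P0 by blast
  have "Z_map q' r' \<zeta> ` graph_of G = graph_of G"
    using Z_map_in_Aut_EL[OF card G \<zeta>0] by (simp add: Aut_EL_def)
  moreover have "?\<gamma>' ` graph_of G = graph_of F"
    using \<gamma>(2) bij by (metis bij_def image_inv_f_f)
  ultimately have "\<tau> ` graph_of F = graph_of F"
    unfolding \<tau>_def image_comp[symmetric] by (simp only: \<gamma>(2))
  moreover have "\<tau> \<in> ELM"
    unfolding \<tau>_def
    by (intro ELM_comp char2 ELM_inv_into Z_map_in_ELM[OF card \<zeta>0] \<gamma>(1))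
  ultimately have \<tau>: "\<tau> \<in> carrier ?A"
    by (simp add: Aut_EL_def)
  have \<tau>_pow: "\<tau> [^]\<^bsub>?A\<^esub> (p ^ e) = \<one>\<^bsub>?A\<^esub>"
    unfolding pow_A \<tau>_def funpow_conjugate[OF inv] Z_map_funpow pow[OF \<zeta>(1)]
    by (simp add: Z_map_one inv ELM_group_def)
  have \<zeta>_pow: "?Z \<zeta> [^]\<^bsub>?A\<^esub> (p ^ e) = \<one>\<^bsub>?A\<^esub>"
    unfolding pow_A Z_map_funpow pow[OF \<zeta>(1)] by (simp add: Z_map_one ELM_group_def)
  have "finite (carrier ?A)"
    by simp
  then obtain g where g: "g \<in> carrier ?A" "g \<otimes>\<^bsub>?A\<^esub> \<tau> \<otimes>\<^bsub>?A\<^esub> inv\<^bsub>?A\<^esub> g \<in> ?S"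
    using A.conjugate_into_sylow[OF _ p S imageI[OF \<zeta>(1)] \<zeta>_pow card_C not_dvd conjugates \<tau> \<tau>_pow]
    by blast
  then have gA: "g \<in> Aut_EL F"
    by simp
  let ?g' = "inv_into UNIV g"
  obtain b where b: "b \<in> P" "g \<circ> \<tau> \<circ> ?g' = ?Z b"
    using g(2) unfolding inv_A(1)[OF gA] by (auto simp: ELM_group_def)
  have gE: "g \<in> ELM" and g'E: "?g' \<in> ELM" "?g' ` graph_of F = graph_of F"
    using gA inv_A(2)[OF gA] by (simp_all add: Aut_EL_def)
  then have "inj g"
    by (simp add: ELM_iff[OF char2] bij_def)
  then have g'g: "?g' \<circ> g = id"
    by simp
  \<comment> \<open>Precomposing with an automorphism of \<open>F\<close> keeps the equivalence, and
    the transported generator becomes the element \<open>?Z b\<close> of the torus of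
    \<open>F\<close>.\<close>
  define \<delta> where "\<delta> = \<gamma> \<circ> ?g'"
  have \<delta>: "\<delta> \<in> ELM" "\<delta> ` graph_of F = graph_of G"
    unfolding \<delta>_def image_comp[symmetric] using ELM_comp[OF char2 \<gamma>(1) g'E(1)] g'E(2) \<gamma>(2) by auto
  have "\<delta> \<circ> ?Z b = \<gamma> \<circ> (?g' \<circ> g) \<circ> \<tau> \<circ> ?g'"
    unfolding b(2)[symmetric] \<delta>_def by (simp add: comp_assoc)
  also have "\<dots> = (\<gamma> \<circ> ?\<gamma>') \<circ> Z_map q' r' \<zeta> \<circ> \<delta>"
    unfolding g'g \<tau>_def \<delta>_def by (simp add: comp_assoc)
  finally have intertwine: "\<delta> \<circ> ?Z b = Z_map q' r' \<zeta> \<circ> \<delta>"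
    by (simp add: inv)
  have "b \<noteq> 1"
  proof
    assume "b = 1"
    then have "Z_map q' r' \<zeta> \<circ> \<delta> = \<delta>"
      using intertwine by (simp add: Z_map_one)
    moreover have "surj \<delta>"
      using \<delta>(1) by (simp add: ELM_iff[OF char2] bij_def)
    ultimately have "Z_map q' r' \<zeta> = Z_map q' r' 1"
      by (metis Z_map_one comp_assoc comp_id surj_iff)
    then show False
      using \<zeta>(2) by (simp add: Z_map_eq_iff)
  qed
  from intertwiner_blocks[OF card ppd this pow[OF b(1)] q \<delta>(1) intertwine] \<delta>
  show ?thesis
    unfolding monomial_EL_equivalence_def EL_equivalent_via_def by metis
qed

subsection \<open>Equivalences with monomial blocks\<close>

lemma cong_uminus_int_iff: "[int a = - int b] (mod int m) \<longleftrightarrow> [a + b = 0] (mod m)"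
  by (simp add: cong_iff_dvd_diff cong_nat_iff_dvd)

text \<open>Two nonzero blocks in one row of \<open>L\<close> would relate \<open>k\<^sub>1\<close>
  and \<open>l\<^sub>1\<close> to the same exponent of \<open>G\<close> up to sign; this brings them
  into the excluded relation with each other.\<close>

lemma cong_up_to_sign_trans:
  fixes k k' l m :: nat
  assumes "[k = k'] (mod m) \<or> [k + k' = 0] (mod m)" "[l = k'] (mod m) \<or> [l + k' = 0] (mod m)"
  shows "[k = l] (mod m) \<or> [k + l = 0] (mod m)"
proof -
  let ?d = "\<lambda>x. int m dvd x"
  have *: "?d (x - y) \<or> ?d (x + y)" if xyz: "?d (x - z) \<or> ?d (x + z)" "?d (y - z) \<or> ?d (y + z)" for x y z :: int
  proof -
    consider "?d (x - z)" "?d (y - z)" | "?d (x - z)" "?d (y + z)"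
      | "?d (x + z)" "?d (y - z)" | "?d (x + z)" "?d (y + z)"
      using xyz by blast
    then show ?thesis
      using dvd_diff[of "int m" "x - z" "y - z"] dvd_add[of "int m" "x - z" "y + z"]
        dvd_add[of "int m" "x + z" "y - z"] dvd_diff[of "int m" "x + z" "y + z"]
      by cases (simp_all add: add.commute)
  qed
  show ?thesis
    using assms *[where x = "int k" and y = "int l" and z = "int k'"]
    unfolding cong_nat_iff_dvd by simp
qed

text \<open>Coefficient 0 stands for the zero block, so every row of the equation has the same
  shape.\<close>

lemma monomial_cases:
  assumes "h = (\<lambda>_. 0) \<or> (\<exists>s. monomial_of_degree s h)"
  obtains c s where "\<And>x. h x = c * x ^ (2 ^ s)" "c = 0 \<longleftrightarrow> h = (\<lambda>_. 0)"
    "c \<noteq> 0 \<Longrightarrow> monomial_of_degree s h"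
proof (cases "h = (\<lambda>_. 0)")
  case False
  then obtain s c where "c \<noteq> 0" "h = (\<lambda>x. c * x ^ (2 ^ s))"
    using assms unfolding monomial_of_degree_def by blast
  then show ?thesis
    using that[of c s] False by (auto simp: monomial_of_degree_def)
qed (use that[of 0 0] in simp)

text \<open>Each row of \<open>L\<close> has at most one nonzero block because
  \<open>k\<^sub>1\<close> and \<open>l\<^sub>1\<close> differ even up to sign, and bijectivity
  forbids a zero row or column. So \<open>L\<close> is diagonal or antidiagonal, and the degrees and
  \<open>N\<close> can be treated row by row.\<close>

lemma monomial_EL_equivalence_types:
  fixes F G :: "'a::{field,finite} \<times> 'a \<Rightarrow> 'a \<times> 'a"
  assumes card: "CARD('a) = 2 ^ m" and "m > 2"
    and F: "biprojective (2 ^ k\<^sub>1) (2 ^ l\<^sub>1) F" and G: "biprojective (2 ^ k\<^sub>2) (2 ^ l\<^sub>2) G"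
    and k: "2 * (k\<^sub>1 mod m) \<noteq> m" and l: "2 * (l\<^sub>1 mod m) \<noteq> m"
    and kl: "\<not> [k\<^sub>1 = l\<^sub>1] (mod m)" "\<not> [k\<^sub>1 + l\<^sub>1 = 0] (mod m)"
    and nonadd: "polar (\<lambda>z. fst (F z)) z w \<noteq> 0" "polar (\<lambda>z. snd (F z)) z' w' \<noteq> 0"
    and equiv: "monomial_EL_equivalence F G t M\<^sub>1 M\<^sub>2 M\<^sub>3 M\<^sub>4 N L\<^sub>1 L\<^sub>2 L\<^sub>3 L\<^sub>4"
  shows "(L\<^sub>2 = (\<lambda>_. 0) \<and> L\<^sub>3 = (\<lambda>_. 0) \<and>
      ([k\<^sub>1 = k\<^sub>2] (mod m) \<or> [k\<^sub>1 + k\<^sub>2 = 0] (mod m)) \<and>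
      ([l\<^sub>1 = l\<^sub>2] (mod m) \<or> [l\<^sub>1 + l\<^sub>2 = 0] (mod m)) \<and>
      ([k\<^sub>1 = k\<^sub>2] (mod m) \<longrightarrow> monomial_of_degree t L\<^sub>1) \<and>
      ([l\<^sub>1 = l\<^sub>2] (mod m) \<longrightarrow> monomial_of_degree t L\<^sub>4) \<and>
      ([k\<^sub>1 + k\<^sub>2 = 0] (mod m) \<longrightarrow> monomial_of_degree (t + k\<^sub>2) L\<^sub>1) \<and>
      ([l\<^sub>1 + l\<^sub>2 = 0] (mod m) \<longrightarrow> monomial_of_degree (t + l\<^sub>2) L\<^sub>4) \<or>
     L\<^sub>1 = (\<lambda>_. 0) \<and> L\<^sub>4 = (\<lambda>_. 0) \<and>
      ([k\<^sub>1 = l\<^sub>2] (mod m) \<or> [k\<^sub>1 + l\<^sub>2 = 0] (mod m)) \<and>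
      ([l\<^sub>1 = k\<^sub>2] (mod m) \<or> [l\<^sub>1 + k\<^sub>2 = 0] (mod m)) \<and>
      ([l\<^sub>1 = k\<^sub>2] (mod m) \<longrightarrow> monomial_of_degree t L\<^sub>2) \<and>
      ([k\<^sub>1 = l\<^sub>2] (mod m) \<longrightarrow> monomial_of_degree t L\<^sub>3) \<and>
      ([l\<^sub>1 + k\<^sub>2 = 0] (mod m) \<longrightarrow> monomial_of_degree (t + k\<^sub>2) L\<^sub>2) \<and>
      ([k\<^sub>1 + l\<^sub>2 = 0] (mod m) \<longrightarrow> monomial_of_degree (t + l\<^sub>2) L\<^sub>3)) \<and>
    (\<not> [k\<^sub>1 = 0] (mod m) \<and> \<not> [l\<^sub>1 = 0] (mod m) \<longrightarrow> N = (\<lambda>_. 0))"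
proof -
  note char2 = pair_add_self_eq_0[OF card]
  note lin = F2_linear_iff_additive[OF char2 char2]
  define M where "M = block M\<^sub>1 M\<^sub>2 M\<^sub>3 M\<^sub>4"
  have m0: "m > 0"
    using \<open>m > 2\<close> by simp
  have M_add: "M (x + y) = M x + M y" and N_add: "N (x + y) = N x + N y"
    and L_bij: "bij (block L\<^sub>1 L\<^sub>2 L\<^sub>3 L\<^sub>4)" for x y
    using equiv unfolding monomial_EL_equivalence_def GL_def lin M_def by blast+
  have M_mono: "\<exists>c. \<forall>x. h x = c * x ^ (2 ^ t)" if "h \<in> {M\<^sub>1, M\<^sub>2, M\<^sub>3, M\<^sub>4}" for h
  proof -
    have "h = (\<lambda>_. 0) \<or> monomial_of_degree t h"
      using equiv that unfolding monomial_EL_equivalence_def by blast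
    then show ?thesis
      unfolding monomial_of_degree_def by (auto intro: exI[of _ 0])
  qed
  obtain d1 d2 d3 d4 where d: "\<And>x. M\<^sub>1 x = d1 * x ^ (2 ^ t)" "\<And>x. M\<^sub>2 x = d2 * x ^ (2 ^ t)"
      "\<And>x. M\<^sub>3 x = d3 * x ^ (2 ^ t)" "\<And>x. M\<^sub>4 x = d4 * x ^ (2 ^ t)"
    using M_mono[of M\<^sub>1] M_mono[of M\<^sub>2] M_mono[of M\<^sub>3] M_mono[of M\<^sub>4] by auto
  have M_scale: "M (scale_pair u z) = scale_pair (u ^ (2 ^ t)) (M z)" for u z
    by (cases z) (simp add: M_def block_def scale_pair_def d power_mult_distrib algebra_simps)
  have L_mono: "h = (\<lambda>_. 0) \<or> (\<exists>s. monomial_of_degree s h)" if "h \<in> {L\<^sub>1, L\<^sub>2, L\<^sub>3, L\<^sub>4}" for h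
    using equiv that unfolding monomial_EL_equivalence_def by blast
  obtain c1 s1 where c1: "\<And>x. L\<^sub>1 x = c1 * x ^ (2 ^ s1)" "c1 = 0 \<longleftrightarrow> L\<^sub>1 = (\<lambda>_. 0)"
      "c1 \<noteq> 0 \<Longrightarrow> monomial_of_degree s1 L\<^sub>1"
    using monomial_cases[OF L_mono[of L\<^sub>1]] by auto
  obtain c2 s2 where c2: "\<And>x. L\<^sub>2 x = c2 * x ^ (2 ^ s2)" "c2 = 0 \<longleftrightarrow> L\<^sub>2 = (\<lambda>_. 0)"
      "c2 \<noteq> 0 \<Longrightarrow> monomial_of_degree s2 L\<^sub>2"
    using monomial_cases[OF L_mono[of L\<^sub>2]] by auto
  obtain c3 s3 where c3: "\<And>x. L\<^sub>3 x = c3 * x ^ (2 ^ s3)" "c3 = 0 \<longleftrightarrow> L\<^sub>3 = (\<lambda>_. 0)"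
      "c3 \<noteq> 0 \<Longrightarrow> monomial_of_degree s3 L\<^sub>3"
    using monomial_cases[OF L_mono[of L\<^sub>3]] by auto
  obtain c4 s4 where c4: "\<And>x. L\<^sub>4 x = c4 * x ^ (2 ^ s4)" "c4 = 0 \<longleftrightarrow> L\<^sub>4 = (\<lambda>_. 0)"
      "c4 \<noteq> 0 \<Longrightarrow> monomial_of_degree s4 L\<^sub>4"
    using monomial_cases[OF L_mono[of L\<^sub>4]] by auto
  let ?f = "\<lambda>z. fst (F z)" and ?g = "\<lambda>z. snd (F z)"
  let ?f' = "\<lambda>z. fst (G z)" and ?g' = "\<lambda>z. snd (G z)"
  note f = biprojective_imp_biform(1)[OF F] and g = biprojective_imp_biform(2)[OF F]
    and f' = biprojective_imp_biform(1)[OF G] and g' = biprojective_imp_biform(2)[OF G]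
  have eq: "G (M z) = N z + block L\<^sub>1 L\<^sub>2 L\<^sub>3 L\<^sub>4 (F z)" for z
  proof -
    let ?\<gamma> = "block M (\<lambda>_. 0) N (block L\<^sub>1 L\<^sub>2 L\<^sub>3 L\<^sub>4)"
    have "?\<gamma> \<in> ELM" "?\<gamma> ` graph_of F = graph_of G"
      using equiv by (simp_all add: monomial_EL_equivalence_def EL_equivalent_via_def M_def)
    then have "snd (?\<gamma> (z, F z)) = G (fst (?\<gamma> (z, F z)))"
      using image_graph_of_eq_iff[OF char2] by blast
    then show ?thesis
      by (simp add: block_def[of M])
  qed
  have row1: "?f' (M z) = fst (N z) + c1 * ?f z ^ (2 ^ s1) + c2 * ?g z ^ (2 ^ s2)" for z
    using eq[of z] by (cases "F z") (simp add: block_def c1(1) c2(1) add.assoc)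
  have row2: "?g' (M z) = snd (N z) + c3 * ?f z ^ (2 ^ s3) + c4 * ?g z ^ (2 ^ s4)" for z
    using eq[of z] by (cases "F z") (simp add: block_def c3(1) c4(1) add.assoc)
  \<comment> \<open>The summands are swapped so that \<open>same_exponents_of_equation\<close>,
    which speaks about the first one, also applies to the second component of
    \<open>F\<close>.\<close>
  have row1': "?f' (M z) = fst (N z) + c2 * ?g z ^ (2 ^ s2) + c1 * ?f z ^ (2 ^ s1)" for z
    using row1[of z] by (simp add: add_ac)
  have row2': "?g' (M z) = snd (N z) + c4 * ?g z ^ (2 ^ s4) + c3 * ?f z ^ (2 ^ s3)" for z
    using row2[of z] by (simp add: add_ac)
  have N1_add: "fst (N (x + y)) = fst (N x) + fst (N y)"
    and N2_add: "snd (N (x + y)) = snd (N x) + snd (N y)" for x y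
    by (simp_all add: N_add)
  have lk: "\<not> [l\<^sub>1 = k\<^sub>1] (mod m)" "\<not> [l\<^sub>1 + k\<^sub>1 = 0] (mod m)"
    using kl by (simp_all add: cong_sym_eq add.commute)
  note se = same_exponents_of_equation[OF card m0]
  have e1: "same_exponents m k\<^sub>1 s1 k\<^sub>2 t" if "c1 \<noteq> 0"
    by (rule se[OF f g f' kl nonadd(1) M_add M_scale N1_add row1 that])
  have e2: "same_exponents m l\<^sub>1 s2 k\<^sub>2 t" if "c2 \<noteq> 0"
    by (rule se[OF g f f' lk nonadd(2) M_add M_scale N1_add row1' that])
  have e3: "same_exponents m k\<^sub>1 s3 l\<^sub>2 t" if "c3 \<noteq> 0"
    by (rule se[OF f g g' kl nonadd(1) M_add M_scale N2_add row2 that])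
  have e4: "same_exponents m l\<^sub>1 s4 l\<^sub>2 t" if "c4 \<noteq> 0"
    by (rule se[OF g f g' lk nonadd(2) M_add M_scale N2_add row2' that])
  have "c1 = 0 \<or> c2 = 0" "c3 = 0 \<or> c4 = 0"
    using e1 e2 e3 e4 kl same_exponents_imp_cong cong_up_to_sign_trans by blast+
  moreover have "\<not> (c1 = 0 \<and> c2 = 0)" "\<not> (c3 = 0 \<and> c4 = 0)"
  proof -
    have "\<exists>u v. fst (block L\<^sub>1 L\<^sub>2 L\<^sub>3 L\<^sub>4 (u, v)) = 1" "\<exists>u v. snd (block L\<^sub>1 L\<^sub>2 L\<^sub>3 L\<^sub>4 (u, v)) = 1"
      using L_bij unfolding bij_def by (metis fst_conv snd_conv surjD surj_pair)+
    then show "\<not> (c1 = 0 \<and> c2 = 0)" "\<not> (c3 = 0 \<and> c4 = 0)"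
      by (auto simp: block_def c1(1) c2(1) c3(1) c4(1))
  qed
  moreover have "\<not> (c1 = 0 \<and> c3 = 0)"
  proof
    assume "c1 = 0 \<and> c3 = 0"
    then have "block L\<^sub>1 L\<^sub>2 L\<^sub>3 L\<^sub>4 (1, 0) = block L\<^sub>1 L\<^sub>2 L\<^sub>3 L\<^sub>4 (0, 0)"
      by (simp add: block_def c1(1) c3(1))
    then show False
      using L_bij by (simp add: bij_def inj_eq)
  qed
  moreover have "\<not> (c2 = 0 \<and> c4 = 0)"
  proof
    assume "c2 = 0 \<and> c4 = 0"
    then have "block L\<^sub>1 L\<^sub>2 L\<^sub>3 L\<^sub>4 (0, 1) = block L\<^sub>1 L\<^sub>2 L\<^sub>3 L\<^sub>4 (0, 0)"
      by (simp add: block_def c2(1) c4(1))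
    then show False
      using L_bij by (simp add: bij_def inj_eq)
  qed
  ultimately consider (A) "c1 \<noteq> 0" "c2 = 0" "c3 = 0" "c4 \<noteq> 0" | (B) "c1 = 0" "c2 \<noteq> 0" "c3 \<noteq> 0" "c4 = 0"
    by blast
  then show ?thesis
  proof cases
    case A
    note s = e1[OF A(1)] e4[OF A(4)]
    have "N z = 0" if "\<not> [k\<^sub>1 = 0] (mod m)" "\<not> [l\<^sub>1 = 0] (mod m)" for z
    proof (rule prod_eqI)
      have r1: "?f' (M z) = fst (N z) + c1 * ?f z ^ (2 ^ s1)" for z
        using row1 A(2) by simp
      have r2: "?g' (M z) = snd (N z) + c4 * ?g z ^ (2 ^ s4)" for z
        using row2 A(3) by simp
      show "fst (N z) = fst 0"
        using additive_part_eq_0[OF card m0 f f' that(1) M_scale N1_add r1 s(1)] by simp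
      show "snd (N z) = snd 0"
        using additive_part_eq_0[OF card m0 g g' that(2) M_scale N2_add r2 s(2)] by simp
    qed
    moreover have "monomial_of_degree t L\<^sub>1" if "[k\<^sub>1 = k\<^sub>2] (mod m)"
      using monomial_of_degree_cong[OF card same_exponents_degree(1)[OF s(1) k that] c1(3)[OF A(1)]] .
    moreover have "monomial_of_degree (t + k\<^sub>2) L\<^sub>1" if "[k\<^sub>1 + k\<^sub>2 = 0] (mod m)"
      using monomial_of_degree_cong[OF card same_exponents_degree(2)[OF s(1) k that] c1(3)[OF A(1)]] .
    moreover have "monomial_of_degree t L\<^sub>4" if "[l\<^sub>1 = l\<^sub>2] (mod m)"
      using monomial_of_degree_cong[OF card same_exponents_degree(1)[OF s(2) l that] c4(3)[OF A(4)]] .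
    moreover have "monomial_of_degree (t + l\<^sub>2) L\<^sub>4" if "[l\<^sub>1 + l\<^sub>2 = 0] (mod m)"
      using monomial_of_degree_cong[OF card same_exponents_degree(2)[OF s(2) l that] c4(3)[OF A(4)]] .
    moreover have "L\<^sub>2 = (\<lambda>_. 0)" "L\<^sub>3 = (\<lambda>_. 0)"
      using A c2(2) c3(2) by simp_all
    ultimately show ?thesis
      using same_exponents_imp_cong[OF s(1)] same_exponents_imp_cong[OF s(2)] by blast
  next
    case B
    note s = e2[OF B(2)] e3[OF B(3)]
    have "N z = 0" if "\<not> [k\<^sub>1 = 0] (mod m)" "\<not> [l\<^sub>1 = 0] (mod m)" for z
    proof (rule prod_eqI)
      have r1: "?f' (M z) = fst (N z) + c2 * ?g z ^ (2 ^ s2)" for z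
        using row1 B(1) by simp
      have r2: "?g' (M z) = snd (N z) + c3 * ?f z ^ (2 ^ s3)" for z
        using row2 B(4) by simp
      show "fst (N z) = fst 0"
        using additive_part_eq_0[OF card m0 g f' that(2) M_scale N1_add r1 s(1)] by simp
      show "snd (N z) = snd 0"
        using additive_part_eq_0[OF card m0 f g' that(1) M_scale N2_add r2 s(2)] by simp
    qed
    moreover have "monomial_of_degree t L\<^sub>2" if "[l\<^sub>1 = k\<^sub>2] (mod m)"
      using monomial_of_degree_cong[OF card same_exponents_degree(1)[OF s(1) l that] c2(3)[OF B(2)]] .
    moreover have "monomial_of_degree (t + k\<^sub>2) L\<^sub>2" if "[l\<^sub>1 + k\<^sub>2 = 0] (mod m)"
      using monomial_of_degree_cong[OF card same_exponents_degree(2)[OF s(1) l that] c2(3)[OF B(2)]] .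
    moreover have "monomial_of_degree t L\<^sub>3" if "[k\<^sub>1 = l\<^sub>2] (mod m)"
      using monomial_of_degree_cong[OF card same_exponents_degree(1)[OF s(2) k that] c3(3)[OF B(3)]] .
    moreover have "monomial_of_degree (t + l\<^sub>2) L\<^sub>3" if "[k\<^sub>1 + l\<^sub>2 = 0] (mod m)"
      using monomial_of_degree_cong[OF card same_exponents_degree(2)[OF s(2) k that] c3(3)[OF B(3)]] .
    moreover have "L\<^sub>1 = (\<lambda>_. 0)" "L\<^sub>4 = (\<lambda>_. 0)"
      using B c1(2) c4(2) by simp_all
    ultimately show ?thesis
      using same_exponents_imp_cong[OF s(1)] same_exponents_imp_cong[OF s(2)] by blast
  qed
qed

theorem theorem4p8:
  fixes F G :: "'a::{field,finite} \<times> 'a \<Rightarrow> 'a \<times> 'a"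
    and m k\<^sub>1 l\<^sub>1 k\<^sub>2 l\<^sub>2 p :: nat
    and P :: "'a set"
  assumes "CARD('a) = 2^m" and "m > 2" and "m \<noteq> 6"
    and "primitive_prime_divisor p m"
    and "sylow_subgroup p mult_group P"
    and "biprojective (2^k\<^sub>1) (2^l\<^sub>1) F"
    and "biprojective (2^k\<^sub>2) (2^l\<^sub>2) G"
    and "2 * (k\<^sub>1 mod m) \<noteq> m" and "2 * (l\<^sub>1 mod m) \<noteq> m"
    and "\<not> [int k\<^sub>1 = int l\<^sub>1] (mod int m)" and "\<not> [int k\<^sub>1 = - int l\<^sub>1] (mod int m)"
    and "\<not> p dvd subgroup_index ELM_group
                   (C_group (2^k\<^sub>1) (2^l\<^sub>1) P F) (Z_group (2^k\<^sub>1) (2^l\<^sub>1))"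
  shows
    "(EL_equivalent F G \<longleftrightarrow>
        (\<exists>t M\<^sub>1 M\<^sub>2 M\<^sub>3 M\<^sub>4 N L\<^sub>1 L\<^sub>2 L\<^sub>3 L\<^sub>4.
           monomial_EL_equivalence F G t M\<^sub>1 M\<^sub>2 M\<^sub>3 M\<^sub>4 N L\<^sub>1 L\<^sub>2 L\<^sub>3 L\<^sub>4)) \<and>
     (\<forall>t M\<^sub>1 M\<^sub>2 M\<^sub>3 M\<^sub>4 N L\<^sub>1 L\<^sub>2 L\<^sub>3 L\<^sub>4.
        monomial_EL_equivalence F G t M\<^sub>1 M\<^sub>2 M\<^sub>3 M\<^sub>4 N L\<^sub>1 L\<^sub>2 L\<^sub>3 L\<^sub>4 \<longrightarrow>
          ((L\<^sub>2 = (\<lambda>_. 0) \<and> L\<^sub>3 = (\<lambda>_. 0) \<and>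
            ([int k\<^sub>1 = int k\<^sub>2] (mod int m) \<or> [int k\<^sub>1 = - int k\<^sub>2] (mod int m)) \<and>
            ([int l\<^sub>1 = int l\<^sub>2] (mod int m) \<or> [int l\<^sub>1 = - int l\<^sub>2] (mod int m)) \<and>
            ([int k\<^sub>1 = int k\<^sub>2] (mod int m) \<longrightarrow> monomial_of_degree t L\<^sub>1) \<and>
            ([int l\<^sub>1 = int l\<^sub>2] (mod int m) \<longrightarrow> monomial_of_degree t L\<^sub>4) \<and>
            ([int k\<^sub>1 = - int k\<^sub>2] (mod int m) \<longrightarrow> monomial_of_degree (t + k\<^sub>2) L\<^sub>1) \<and>
            ([int l\<^sub>1 = - int l\<^sub>2] (mod int m) \<longrightarrow> monomial_of_degree (t + l\<^sub>2) L\<^sub>4))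
           \<or>
           (L\<^sub>1 = (\<lambda>_. 0) \<and> L\<^sub>4 = (\<lambda>_. 0) \<and>
            ([int k\<^sub>1 = int l\<^sub>2] (mod int m) \<or> [int k\<^sub>1 = - int l\<^sub>2] (mod int m)) \<and>
            ([int l\<^sub>1 = int k\<^sub>2] (mod int m) \<or> [int l\<^sub>1 = - int k\<^sub>2] (mod int m)) \<and>
            ([int l\<^sub>1 = int k\<^sub>2] (mod int m) \<longrightarrow> monomial_of_degree t L\<^sub>2) \<and>
            ([int k\<^sub>1 = int l\<^sub>2] (mod int m) \<longrightarrow> monomial_of_degree t L\<^sub>3) \<and>
            ([int l\<^sub>1 = - int k\<^sub>2] (mod int m) \<longrightarrow> monomial_of_degree (t + k\<^sub>2) L\<^sub>2) \<and>
            ([int k\<^sub>1 = - int l\<^sub>2] (mod int m) \<longrightarrow> monomial_of_degree (t + l\<^sub>2) L\<^sub>3))) \<and>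
          (\<not> [int k\<^sub>1 = 0] (mod int m) \<and> \<not> [int l\<^sub>1 = 0] (mod int m) \<longrightarrow> N = (\<lambda>_. 0))) \<and>
     (\<not> [int k\<^sub>1 = 0] (mod int m) \<and> \<not> [int l\<^sub>1 = 0] (mod int m) \<longrightarrow>
        EL_equivalent F G \<longrightarrow> linear_equivalent F G)"
proof -
  note card = assms(1) and ppd = assms(4) and P = assms(5) and F = assms(6) and G = assms(7)
  note index = assms(12)
  have m: "m > 0" "m > 1"
    using \<open>m > 2\<close> by simp_all
  note cong_nat = cong_int_iff cong_int_iff[of _ 0, unfolded of_nat_0] cong_uminus_int_iff
  have kl: "\<not> [k\<^sub>1 = l\<^sub>1] (mod m)" "\<not> [k\<^sub>1 + l\<^sub>1 = 0] (mod m)"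
    using assms(10,11) by (simp_all only: cong_nat not_False_eq_True)
  have "subgroup P mult_group"
    using P by (simp add: sylow_subgroup_def)
  then have P0: "0 \<notin> P"
    using subgroup.subset by (fastforce simp: mult_group_def)
  have p: "p dvd 2 ^ m - 1"
    using ppd by (simp add: primitive_prime_divisor_def)
  \<comment> \<open>Were this component additive, \<open>\<alpha> a = a\<close> and
    \<open>\<beta> a = 1\<close> would scale its deviation from the graph and give the second torus;
    for the other component the roles are exchanged.\<close>
  have "\<exists>z w. polar (\<lambda>z. fst (F z)) z w \<noteq> 0"
  proof (rule ccontr)
    assume "\<not> ?thesis"
    then have "2 ^ m - 1 dvd subgroup_index ELM_group
        (C_group (2 ^ k\<^sub>1) (2 ^ l\<^sub>1) P F) (Z_group (2 ^ k\<^sub>1) (2 ^ l\<^sub>1))"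
      by (intro dvd_subgroup_index[OF card m(1) F P0, of "\<lambda>a. a" "\<lambda>_. 1"]) auto
    then show False
      using index p by (meson dvd_trans)
  qed
  then obtain z w where f: "polar (\<lambda>z. fst (F z)) z w \<noteq> 0"
    by blast
  have "\<exists>z w. polar (\<lambda>z. snd (F z)) z w \<noteq> 0"
  proof (rule ccontr)
    assume "\<not> ?thesis"
    then have "2 ^ m - 1 dvd subgroup_index ELM_group
        (C_group (2 ^ k\<^sub>1) (2 ^ l\<^sub>1) P F) (Z_group (2 ^ k\<^sub>1) (2 ^ l\<^sub>1))"
      by (intro dvd_subgroup_index[OF card m(1) F P0, of "\<lambda>_. 1" "\<lambda>a. a"]) auto
    then show False
      using index p by (meson dvd_trans)
  qed
  then obtain z' w' where g: "polar (\<lambda>z. snd (F z)) z' w' \<noteq> 0"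
    by blast
  note types = monomial_EL_equivalence_types[OF card assms(2) F G assms(8,9) kl f g]
  have q: "\<not> p dvd 2 ^ k\<^sub>1 + 1" "\<not> p dvd 2 ^ l\<^sub>1 + 1"
    using primitive_prime_divisor_not_dvd[OF ppd _ m(2)] assms(8,9) by blast+
  have iff: "EL_equivalent F G \<longleftrightarrow>
      (\<exists>t M\<^sub>1 M\<^sub>2 M\<^sub>3 M\<^sub>4 N L\<^sub>1 L\<^sub>2 L\<^sub>3 L\<^sub>4.
        monomial_EL_equivalence F G t M\<^sub>1 M\<^sub>2 M\<^sub>3 M\<^sub>4 N L\<^sub>1 L\<^sub>2 L\<^sub>3 L\<^sub>4)"
  proof
    show "EL_equivalent F G \<Longrightarrow> \<exists>t M\<^sub>1 M\<^sub>2 M\<^sub>3 M\<^sub>4 N L\<^sub>1 L\<^sub>2 L\<^sub>3 L\<^sub>4.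
        monomial_EL_equivalence F G t M\<^sub>1 M\<^sub>2 M\<^sub>3 M\<^sub>4 N L\<^sub>1 L\<^sub>2 L\<^sub>3 L\<^sub>4"
      by (rule EL_equivalent_imp_monomial[OF card assms(2) ppd P F G q index])
  qed (auto simp: monomial_EL_equivalence_def EL_equivalent_def)
  have "linear_equivalent F G"
    if k0: "\<not> [k\<^sub>1 = 0] (mod m) \<and> \<not> [l\<^sub>1 = 0] (mod m)" and "EL_equivalent F G"
  proof -
    obtain t M\<^sub>1 M\<^sub>2 M\<^sub>3 M\<^sub>4 N L\<^sub>1 L\<^sub>2 L\<^sub>3 L\<^sub>4 where
      equiv: "monomial_EL_equivalence F G t M\<^sub>1 M\<^sub>2 M\<^sub>3 M\<^sub>4 N L\<^sub>1 L\<^sub>2 L\<^sub>3 L\<^sub>4"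
      using iff \<open>EL_equivalent F G\<close> by metis
    then have "N = (\<lambda>_. 0)"
      using types[OF equiv] k0 by blast
    then show ?thesis
      using equiv unfolding monomial_EL_equivalence_def linear_equivalent_def by blast
  qed
  then show ?thesis
    unfolding cong_nat by (intro conjI iff allI impI types) blast+
qed

end
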